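(* Let $K$ be an algebraically closed field complete with respect to a nontrivial nonarchimedean absolute value, let $\varphi:\mathbb{P}^N_K\to\mathbb{P}^N_K$ be a morphism of degree $d\ge2$, let $\Phi$ be a lift of $\varphi$, let $\hat g_\Phi$ be the modified Green function, and let $P\in\mathbb{P}^N(K)$. The following are equivalent: (a) $P\in\mathcal{F}(\varphi)$, i.e. the iterates of $\varphi$ are equicontinuous at every point of some neighborhood of $P$; (b) the iterates of $\varphi$ are locally uniformly Lipschitz at $P$, i.e. there exist $r>0$ and $C>0$ with $\Delta(\varphi^n(Q),\varphi^n(R))\le C\,\Delta(Q,R)$ for all $Q,R\in\bar D_r(P)$ and all $n\ge0$; (c) $\hat g_\Phi$ is constant on a neighborhood of $P$.
   Context: For $x\in K^{N+1}$, $\|x\|=\max_i|x_i|$, and $\pi:K^{N+1}\setminus\{0\}\to\mathbb{P}^N(K)$ is the projection. The chordal distance of $P=\pi(x)$, $Q=\pi(y)$ is $\Delta(P,Q)=\max_{i,j}|x_iy_j-x_jy_i|/(\|x\|\,\|y\|)$, and $\bar D_r(P)=\{Q:\Delta(P,Q)\le r\}$. A lift of $\varphi$ is a tuple $\Phi=(\Phi_0,\dots,\Phi_N)$ of degree-$d$ homogeneous polynomials over $K$ with no common nontrivial zero and $\varphi\circ\pi=\pi\circ\Phi$. The Green function is $G_\Phi(x)=\lim_{n\to\infty}d^{-n}\log\|\Phi^n(x)\|$ (the limit exists) and $\hat g_\Phi(P)=G_\Phi(x)-\log\|x\|$ for $x\in\pi^{-1}(P)$. A family of maps is equicontinuous at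 $P$ if for every $\epsilon>0$ there is $\delta>0$ with $\Delta(\psi(P),\psi(Q))<\epsilon$ whenever $\Delta(P,Q)<\delta$, for all $\psi$ in the family. The Fatou set $\mathcal{F}(\varphi)$ is the union of all open sets $U\subseteq\mathbb{P}^N(K)$ such that $\{\varphi^n\}_{n\ge1}$ is equicontinuous at every point of $U$. *)

theory Defs
  imports Complex_Main "HOL-Computational_Algebra.Polynomial"
begin

definition nonarch_abs :: "('k::field \<Rightarrow> real) \<Rightarrow> bool" where
  "nonarch_abs v \<longleftrightarrow>
     (\<forall>x. 0 \<le> v x) \<and> (\<forall>x. v x = 0 \<longleftrightarrow> x = 0) \<and>
     (\<forall>x y. v (x * y) = v x * v y) \<and> (\<forall>x y. v (x + y) \<le> max (v x) (v y))"

definition nontrivial_abs :: "('k::field \<Rightarrow> real) \<Rightarrow> bool" where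
  "nontrivial_abs v \<longleftrightarrow> (\<exists>x. x \<noteq> 0 \<and> v x \<noteq> 1)"

definition complete_abs :: "('k::field \<Rightarrow> real) \<Rightarrow> bool" where
  "complete_abs v \<longleftrightarrow>
     (\<forall>s :: nat \<Rightarrow> 'k. (\<forall>e>0. \<exists>M. \<forall>m\<ge>M. \<forall>n\<ge>M. v (s m - s n) < e) \<longrightarrow>
        (\<exists>L. \<forall>e>0. \<exists>M. \<forall>n\<ge>M. v (s n - L) < e))"

definition alg_closed :: "'k::field itself \<Rightarrow> bool" where
  "alg_closed _ \<longleftrightarrow> (\<forall>p :: 'k poly. 0 < degree p \<longrightarrow> (\<exists>x. poly p x = 0))"

definition kvec :: "nat \<Rightarrow> (nat \<Rightarrow> 'k::field) set" where
  "kvec N = {x. \<forall>i>N. x i = 0}"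

definition vnorm :: "('k::field \<Rightarrow> real) \<Rightarrow> nat \<Rightarrow> (nat \<Rightarrow> 'k) \<Rightarrow> real" where
  "vnorm v N x = Max ((\<lambda>i. v (x i)) ` {..N})"

definition chordal_vec :: "('k::field \<Rightarrow> real) \<Rightarrow> nat \<Rightarrow> (nat \<Rightarrow> 'k) \<Rightarrow> (nat \<Rightarrow> 'k) \<Rightarrow> real" where
  "chordal_vec v N x y =
     Max ((\<lambda>(i,j). v (x i * y j - x j * y i)) ` ({..N} \<times> {..N})) / (vnorm v N x * vnorm v N y)"

definition proj :: "nat \<Rightarrow> (nat \<Rightarrow> 'k::field) \<Rightarrow> (nat \<Rightarrow> 'k) set" where
  "proj N x = {y \<in> kvec N. \<exists>c. c \<noteq> 0 \<and> y = (\<lambda>i. c * x i)}"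

definition PN :: "nat \<Rightarrow> (nat \<Rightarrow> 'k::field) set set" where
  "PN N = {proj N x | x. x \<in> kvec N \<and> x \<noteq> (\<lambda>_. 0)}"

definition rep :: "(nat \<Rightarrow> 'k) set \<Rightarrow> (nat \<Rightarrow> 'k)" where
  "rep P = (SOME x. x \<in> P)"

text \<open>Chordal distance of points (independent of the chosen representatives).\<close>
definition chordal :: "('k::field \<Rightarrow> real) \<Rightarrow> nat \<Rightarrow> (nat \<Rightarrow> 'k) set \<Rightarrow> (nat \<Rightarrow> 'k) set \<Rightarrow> real" where
  "chordal v N P Q = chordal_vec v N (rep P) (rep Q)"

definition closed_disk :: "('k::field \<Rightarrow> real) \<Rightarrow> nat \<Rightarrow> (nat \<Rightarrow> 'k) set \<Rightarrow> real \<Rightarrow> (nat \<Rightarrow> 'k) set set" where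
  "closed_disk v N P r = {Q \<in> PN N. chordal v N P Q \<le> r}"

definition chordal_open :: "('k::field \<Rightarrow> real) \<Rightarrow> nat \<Rightarrow> (nat \<Rightarrow> 'k) set set \<Rightarrow> bool" where
  "chordal_open v N U \<longleftrightarrow> U \<subseteq> PN N \<and>
     (\<forall>P\<in>U. \<exists>r>0. {Q \<in> PN N. chordal v N P Q < r} \<subseteq> U)"

text \<open>A polynomial is given by its coefficient function on exponent vectors (nat => nat).\<close>
definition homog_poly :: "nat \<Rightarrow> nat \<Rightarrow> ((nat \<Rightarrow> nat) \<Rightarrow> 'k::field) \<Rightarrow> bool" where
  "homog_poly N d c \<longleftrightarrow> finite {a. c a \<noteq> 0} \<and>
     (\<forall>a. c a \<noteq> 0 \<longrightarrow> (\<forall>i>N. a i = 0) \<and> (\<Sum>i\<le>N. a i) = d)"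

definition eval_poly :: "nat \<Rightarrow> ((nat \<Rightarrow> nat) \<Rightarrow> 'k::field) \<Rightarrow> (nat \<Rightarrow> 'k) \<Rightarrow> 'k" where
  "eval_poly N c x = (\<Sum>a\<in>{a. c a \<noteq> 0}. c a * (\<Prod>i\<le>N. x i ^ a i))"

definition eval_map :: "nat \<Rightarrow> (nat \<Rightarrow> (nat \<Rightarrow> nat) \<Rightarrow> 'k::field) \<Rightarrow> (nat \<Rightarrow> 'k) \<Rightarrow> (nat \<Rightarrow> 'k)" where
  "eval_map N Phi x = (\<lambda>j. if j \<le> N then eval_poly N (Phi j) x else 0)"

definition is_lift :: "nat \<Rightarrow> nat \<Rightarrow> (nat \<Rightarrow> (nat \<Rightarrow> nat) \<Rightarrow> 'k::field)
     \<Rightarrow> ((nat \<Rightarrow> 'k) set \<Rightarrow> (nat \<Rightarrow> 'k) set) \<Rightarrow> bool" where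
  "is_lift N d Phi phi \<longleftrightarrow>
     (\<forall>j\<le>N. homog_poly N d (Phi j)) \<and>
     (\<forall>x\<in>kvec N. x \<noteq> (\<lambda>_. 0) \<longrightarrow> eval_map N Phi x \<noteq> (\<lambda>_. 0)) \<and>
     (\<forall>x\<in>kvec N. x \<noteq> (\<lambda>_. 0) \<longrightarrow> phi (proj N x) = proj N (eval_map N Phi x))"

definition green :: "('k::field \<Rightarrow> real) \<Rightarrow> nat \<Rightarrow> nat \<Rightarrow> (nat \<Rightarrow> (nat \<Rightarrow> nat) \<Rightarrow> 'k)
     \<Rightarrow> (nat \<Rightarrow> 'k) \<Rightarrow> real" where
  "green v N d Phi x = lim (\<lambda>n. ln (vnorm v N ((eval_map N Phi ^^ n) x)) / real d ^ n)"

definition green_hat :: "('k::field \<Rightarrow> real) \<Rightarrow> nat \<Rightarrow> nat \<Rightarrow> (nat \<Rightarrow> (nat \<Rightarrow> nat) \<Rightarrow> 'k)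
     \<Rightarrow> (nat \<Rightarrow> 'k) set \<Rightarrow> real" where
  "green_hat v N d Phi P = green v N d Phi (rep P) - ln (vnorm v N (rep P))"

definition equicont_at :: "('k::field \<Rightarrow> real) \<Rightarrow> nat \<Rightarrow> ((nat \<Rightarrow> 'k) set \<Rightarrow> (nat \<Rightarrow> 'k) set)
     \<Rightarrow> (nat \<Rightarrow> 'k) set \<Rightarrow> bool" where
  "equicont_at v N phi P \<longleftrightarrow>
     (\<forall>e>0. \<exists>\<delta>>0. \<forall>n\<ge>1. \<forall>Q\<in>PN N. chordal v N P Q < \<delta> \<longrightarrow>
        chordal v N ((phi ^^ n) P) ((phi ^^ n) Q) < e)"

definition fatou :: "('k::field \<Rightarrow> real) \<Rightarrow> nat \<Rightarrow> ((nat \<Rightarrow> 'k) set \<Rightarrow> (nat \<Rightarrow> 'k) set)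
     \<Rightarrow> (nat \<Rightarrow> 'k) set set" where
  "fatou v N phi = \<Union>{U. chordal_open v N U \<and> (\<forall>Q\<in>U. equicont_at v N phi Q)}"

end

theory Submission
  imports Defs "HOL-Library.Function_Algebras" "HOL-Library.Countable_Set"
begin

text \<open>
  Write \<open>F\<close> for the lift. Its iterates are polynomial maps, and
  \<open>\<bar>ln \<parallel>F x\<parallel> - d * ln \<parallel>x\<parallel>\<bar>\<close> is bounded; the lower bound for \<open>\<parallel>F x\<parallel>\<close> comes from the weak
  Nullstellensatz, which has a short proof here because a complete nontrivially valued field is
  uncountable. Hence \<open>ln \<parallel>F\<^sup>n x\<parallel> = d\<^sup>n * G x + O(1)\<close> uniformly in \<open>x\<close> and \<open>n\<close>.

  If the iterates are equicontinuous at \<open>P\<close>, then on a small polydisc of normalized lifts one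
  coordinate of \<open>F\<^sup>n\<close> dominates all others. It has no zeros there, so \<open>\<parallel>F\<^sup>n\<parallel>\<close> is constant, and so
  is \<open>G\<close>. If \<open>G\<close> is constant on a polydisc, then \<open>\<parallel>F\<^sup>n\<parallel>\<close> lies there between multiples of
  \<open>exp (d\<^sup>n * G)\<close> that do not depend on \<open>n\<close>. The nonarchimedean Cauchy estimate bounds the Lipschitz
  constant of \<open>F\<^sup>n\<close> by its maximum, and dividing by \<open>\<parallel>F\<^sup>n\<parallel>\<close> gives a uniform chordal Lipschitz
  constant for \<open>phi\<^sup>n\<close>. The last implication follows from the ultrametric inequality.
\<close>

section \<open>Nonarchimedean absolute values\<close>

locale nonarch =
  fixes v :: "'k::field \<Rightarrow> real"
  assumes nonarch: "nonarch_abs v"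
begin

lemma v_nonneg [simp]: "0 \<le> v x"
  and v_eq_0_iff [simp]: "v x = 0 \<longleftrightarrow> x = 0"
  and v_mult: "v (x * y) = v x * v y"
  and v_add: "v (x + y) \<le> max (v x) (v y)"
  using nonarch unfolding nonarch_abs_def by auto

lemma v_zero [simp]: "v 0 = 0"
  by simp

lemma v_pos_iff [simp]: "0 < v x \<longleftrightarrow> x \<noteq> 0"
  by (metis less_le v_nonneg v_eq_0_iff)

lemma v_one [simp]: "v 1 = 1"
  using v_mult[of 1 1] v_eq_0_iff[of 1] by auto

lemma v_minus [simp]: "v (- x) = v x"
proof -
  have "v (-1) * v (-1) = 1"
    using v_mult[of "-1" "-1"] by simp
  then have "v (-1) = 1"
    using v_nonneg[of "-1"] abs_square_eq_1[of "v (-1)"] by (simp add: power2_eq_square)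
  then show ?thesis
    using v_mult[of "-1" x] by simp
qed

lemma v_minus_commute: "v (x - y) = v (y - x)"
  using v_minus[of "x - y"] by simp

lemma v_diff: "v (x - y) \<le> max (v x) (v y)"
  using v_add[of x "-y"] by simp

lemma v_power: "v (x ^ n) = v x ^ n"
  by (induction n) (auto simp: v_mult)

lemma v_inverse: "v (inverse x) = inverse (v x)"
proof (cases "x = 0")
  case False
  then have "v x * v (inverse x) = 1"
    by (simp flip: v_mult)
  then show ?thesis
    by (metis inverse_unique)
qed simp

lemma v_sum_le:
  assumes "\<And>i. i \<in> A \<Longrightarrow> v (f i) \<le> B" "0 \<le> B"
  shows "v (sum f A) \<le> B"
  using assms
proof (induction A rule: infinite_finite_induct)
  case (insert a A)
  then show ?case
    using v_add[of "f a" "sum f A"] by (force simp: max_def split: if_splits)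
qed auto

text \<open>If \<open>v b < v a\<close>, writing \<open>a = (a + b) - b\<close> gives
  \<open>v a \<le> max (v (a + b)) (v b)\<close>, and the maximum cannot be
  \<open>v b\<close>.\<close>

lemma v_add_eq_max:
  assumes "v x \<noteq> v y"
  shows "v (x + y) = max (v x) (v y)"
proof -
  have *: "v (a + b) = v a" if "v b < v a" for a b
    using v_add[of a b] v_diff[of "a + b" b] that by (auto simp: max_def split: if_splits)
  show ?thesis
    using *[of x y] *[of y x] assms by (cases "v y < v x") (auto simp: add.commute)
qed

lemma v_diff_eq_max: "v x \<noteq> v y \<Longrightarrow> v (x - y) = max (v x) (v y)"
  using v_add_eq_max[of x "-y"] by simp

end

locale nontrivial_nonarch = nonarch v for v :: "'k::field \<Rightarrow> real" +
  assumes nontrivial: "nontrivial_abs v"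
begin

lemma ex_v_gt_1: obtains x where "1 < v x"
proof -
  obtain x where x: "x \<noteq> 0" "v x \<noteq> 1"
    using nontrivial unfolding nontrivial_abs_def by blast
  show ?thesis
  proof (cases "1 < v x")
    case False
    with x have "1 < v (inverse x)"
      by (simp add: v_inverse one_less_inverse_iff)
    then show ?thesis by (rule that)
  qed (rule that)
qed

text \<open>The sums \<open>\<Sum>i\<in>A. w ^ i\<close> with \<open>0 < \<bar>w\<bar> < 1\<close> are distinct for distinct sets \<open>A\<close>.\<close>
lemma uncountable_complete:
  assumes "complete_abs v"
  shows "uncountable (UNIV :: 'k set)"
proof
  assume count: "countable (UNIV :: 'k set)"
  obtain x where "1 < v x" by (rule ex_v_gt_1)
  define w where "w = inverse x"
  have w: "0 < v w" "v w < 1"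
    using \<open>1 < v x\<close> v_zero unfolding w_def v_inverse by (auto simp: inverse_less_1_iff)
  define s where "s = (\<lambda>A n. \<Sum>i<n. if i \<in> A then w ^ i else 0)"
  have step: "v (s A (n + k) - s A n) \<le> v w ^ n" for A n k
  proof -
    have "s A (n + k) - s A n = (\<Sum>i\<in>{n..<n+k}. if i \<in> A then w ^ i else 0)"
      unfolding s_def lessThan_atLeast0 by (subst sum.atLeastLessThan_concat[of 0 n, symmetric]) auto
    also have "v \<dots> \<le> v w ^ n"
      using w by (intro v_sum_le) (auto simp: v_power intro: power_decreasing)
    finally show ?thesis .
  qed
  have step': "v (s A m - s A n) \<le> v w ^ M" if "m \<ge> M" "n \<ge> M" for A m n M
  proof -
    have "v (s A m - s A M) \<le> v w ^ M" "v (s A M - s A n) \<le> v w ^ M"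
      using step[of A M "m - M"] step[of A M "n - M"] that by (auto simp: v_minus_commute)
    then show ?thesis
      using v_add[of "s A m - s A M" "s A M - s A n"] by auto
  qed
  have "\<exists>L. \<forall>e>0. \<exists>M. \<forall>n\<ge>M. v (s A n - L) < e" for A
  proof -
    have "\<exists>M. \<forall>m\<ge>M. \<forall>n\<ge>M. v (s A m - s A n) < e" if e: "e > 0" for e
    proof -
      obtain M where "v w ^ M < e"
        using real_arch_pow_inv[OF e w(2)] by blast
      then show ?thesis
        using step'[of M _ _ A] by (meson le_less_trans)
    qed
    then show ?thesis
      using assms unfolding complete_abs_def by blast
  qed
  then obtain L where L: "\<And>A e. e > 0 \<Longrightarrow> \<exists>M. \<forall>n\<ge>M. v (s A n - L A) < e"
    by metis
  have tail: "v (s A n - L A) \<le> v w ^ n" for A n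
  proof -
    obtain M where M: "\<And>m. m \<ge> M \<Longrightarrow> v (s A m - L A) < v w ^ n"
      using L[of "v w ^ n" A] w by auto
    have "v (s A n - s A (max M n)) \<le> v w ^ n" "v (s A (max M n) - L A) \<le> v w ^ n"
      using step'[of n n "max M n" A] M[of "max M n"] by auto
    then show ?thesis
      using v_add[of "s A n - s A (max M n)" "s A (max M n) - L A"] by auto
  qed
  have "inj L"
  proof (rule injI, rule ccontr)
    fix A B assume eq: "L A = L B" and "A \<noteq> B"
    then obtain k where "(k \<in> A) \<noteq> (k \<in> B)" by blast
    \<comment> \<open>At the first index where the sets differ the partial sums separate by exactly
      \<open>v w ^ n\<close>, while both are within \<open>v w ^ Suc n\<close> of the common
      limit.\<close>
    define n where "n = (LEAST k. (k \<in> A) \<noteq> (k \<in> B))"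
    have n: "(n \<in> A) \<noteq> (n \<in> B)"
      unfolding n_def by (rule LeastI) fact
    have below: "(i \<in> A) = (i \<in> B)" if "i < n" for i
      using not_less_Least that unfolding n_def by blast
    have "s A n = s B n"
      unfolding s_def by (intro sum.cong) (auto simp: below)
    then have "v (s A (Suc n) - s B (Suc n)) = v w ^ n"
      using n by (auto simp: s_def v_power)
    moreover have "v (s A (Suc n) - s B (Suc n)) \<le> v w ^ Suc n"
      using v_diff[of "s A (Suc n) - L A" "s B (Suc n) - L B"] tail[of A "Suc n"] tail[of B "Suc n"] eq
      by auto
    ultimately have "v w ^ n \<le> v w ^ Suc n" by simp
    then show False using w by simp
  qed
  then have "countable (UNIV :: nat set set)"
    using count countableI' by (metis countable_image_inj_on countable_subset subset_UNIV)
  then obtain f :: "nat set \<Rightarrow> nat" where "inj f"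
    unfolding countable_def by auto
  then have "surj (inv f)" by (rule inj_imp_surj_inv)
  then show False
    using Cantors_theorem[of UNIV] by (metis Pow_UNIV)
qed

end

section \<open>Absolute values of polynomials in one variable over an algebraically closed
  field\<close>

locale alg_closed_nonarch = nontrivial_nonarch v for v :: "'k::field \<Rightarrow> real" +
  assumes closed: "alg_closed TYPE('k)"
begin

lemma ex_root: "0 < degree (p :: 'k poly) \<Longrightarrow> \<exists>x. poly p x = 0"
  using closed unfolding alg_closed_def by blast

text \<open>Roots make the value group divisible: for \<open>1 < v x\<close>, an \<open>n\<close>-th
  root \<open>t\<close> of \<open>x powi m\<close> has \<open>ln (v t) = (m / n) * ln (v x)\<close>,
  and rational multiples of a positive number are dense.\<close>

lemma value_group_dense:
  assumes "0 < a" "a < b"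
  obtains t where "a < v t" "v t < b"
proof -
  obtain x where x: "1 < v x" by (rule ex_v_gt_1)
  define c where "c = ln (v x)"
  have c: "c > 0" using x unfolding c_def by (rule ln_gt_zero)
  have "ln a / c < ln b / c"
    using assms c by (simp add: divide_strict_right_mono)
  then obtain q where q: "q \<in> \<rat>" "ln a / c < q" "q < ln b / c"
    using Rats_dense_in_real by blast
  obtain m n where mn: "q = real_of_int m / real n" "n > 0"
    using q(1) by (metis Rats_cases' of_int_of_nat_eq zero_less_imp_eq_int of_nat_0_less_iff)
  define y where "y = x powi m"
  have y: "y \<noteq> 0" "ln (v y) = m * c"
  proof -
    have "v (x powi m) = v x powi m"
      by (simp add: power_int_def v_power v_inverse)
    moreover have "v x powi m = v x powr m"
      using x by (intro powr_real_of_int' [symmetric]) auto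
    then have "ln (v x powi m) = m * c"
      using x unfolding c_def by (simp add: ln_powr)
    ultimately show "ln (v y) = m * c" by (simp add: y_def)
    show "y \<noteq> 0" using x unfolding y_def by auto
  qed
  have "n \<le> degree (monom 1 n - [:y:])"
    using mn(2) by (intro le_degree) (auto simp: coeff_pCons split: nat.splits)
  then obtain t where "poly (monom 1 n - [:y:]) t = 0"
    using ex_root[of "monom 1 n - [:y:]"] mn(2) by auto
  then have t: "t ^ n = y" by (simp add: poly_monom)
  then have t0: "t \<noteq> 0" using y(1) mn(2) by (metis zero_power)
  have "real n * ln (v t) = m * c"
    using t y(2) t0 by (metis ln_realpow v_power v_pos_iff)
  then have lnt: "ln (v t) = q * c"
    using mn by (metis mult.assoc mult.commute mult_left_cancel nonzero_eq_divide_eq of_nat_0 of_nat_eq_iff less_numeral_extra(3))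
  have "ln a < ln (v t)" "ln (v t) < ln b"
    using q(2,3) c unfolding lnt by (simp_all add: field_simps)
  then have "a < v t" "v t < b"
    using assms t0 by auto
  then show ?thesis by (rule that)
qed

text \<open>Shrinking \<open>b\<close> to the smallest forbidden value above \<open>a\<close> leaves
  an open interval without forbidden values.\<close>

lemma value_group_dense_avoiding:
  assumes "0 < a" "a < b" "finite S"
  obtains t where "a < v t" "v t < b" "v t \<notin> S"
proof -
  define b' where "b' = Min (insert b {s \<in> S. a < s})"
  have "a < b'"
    using assms by (auto simp: b'_def)
  then obtain t where t: "a < v t" "v t < b'"
    using value_group_dense assms(1) by blast
  have b': "b' \<le> s" if "s \<in> insert b {s \<in> S. a < s}" for s
    unfolding b'_def using that assms(3) by (intro Min_le) auto
  show ?thesis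
    using b'[of b] b'[of "v t"] t by (intro that[of t]) auto
qed

text \<open>Nonzero polynomials split into linear factors, so a multiplicative statement about
  \<open>v (poly p t)\<close> only has to survive one factor \<open>t - a\<close> at a time.\<close>

lemma poly_root_factor_induct [consumes 1, case_names const factor]:
  assumes "p \<noteq> (0 :: 'k poly)"
    and "\<And>c. c \<noteq> 0 \<Longrightarrow> Q [:c:]"
    and "\<And>a q. q \<noteq> 0 \<Longrightarrow> Q q \<Longrightarrow> Q ([:-a, 1:] * q)"
  shows "Q p"
  using assms(1)
proof (induction "degree p" arbitrary: p)
  case 0
  then obtain c where "p = [:c:]" by (metis degree_eq_zeroE)
  with 0 assms(2)[of c] show ?case by auto
next
  case (Suc n)
  then obtain a where "poly p a = 0"
    using ex_root[of p] by auto
  then obtain q where q: "p = [:-a, 1:] * q"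
    by (auto simp: poly_eq_0_iff_dvd)
  with Suc.prems have "q \<noteq> 0" by auto
  moreover have "degree p = Suc (degree q)"
    unfolding q using \<open>q \<noteq> 0\<close> by (subst degree_mult_eq) auto
  ultimately show ?case
    using Suc assms(3)[of q a] q by auto
qed

text \<open>A maximum principle: if \<open>\<bar>t\<bar>\<close> differs from \<open>\<bar>a\<bar>\<close> for every root \<open>a\<close>,
  then \<open>\<bar>t - a\<bar> = max \<bar>t\<bar> \<bar>a\<bar>\<close> is at least \<open>\<bar>s - a\<bar>\<close> whenever \<open>\<bar>s\<bar> \<le> \<bar>t\<bar>\<close>.\<close>
lemma poly_max_principle:
  assumes "0 < a" "a < b"
  obtains t where "a < v t" "v t < b" "\<And>s. v s \<le> a \<Longrightarrow> v (poly q s) \<le> v (poly q t)"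
proof (cases "q = 0")
  case True
  then show ?thesis
    using value_group_dense[OF assms] that by auto
next
  case False
  then obtain t where t: "a < v t" "v t < b" "v t \<notin> v ` {x. poly q x = 0}"
    using value_group_dense_avoiding[OF assms, of "v ` {x. poly q x = 0}"] poly_roots_finite by blast
  have "v (poly q s) \<le> v (poly q t)" if "v s \<le> a" for s
    using False t(3)
  proof (induction rule: poly_root_factor_induct)
    case (factor c q)
    have "v (t - c) = max (v t) (v c)"
      using factor.prems by (intro v_diff_eq_max) (auto simp: image_iff)
    moreover have "v (s - c) \<le> max (v s) (v c)"
      by (rule v_diff)
    ultimately have "v (s - c) \<le> v (t - c)"
      using that t(1) by auto
    moreover have "v (poly q s) \<le> v (poly q t)"
      using factor by (auto simp: image_iff)
    ultimately have "v (s - c) * v (poly q s) \<le> v (t - c) * v (poly q t)"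
      by (intro mult_mono) auto
    then show ?case
      by (simp add: v_mult[symmetric] algebra_simps)
  qed simp
  with t show ?thesis by (intro that) auto
qed

text \<open>Every root \<open>c\<close> has \<open>v c > b \<ge> v s\<close>, hence
  \<open>v (s - c) = v c = v (0 - c)\<close>: no linear factor changes its absolute value between
  \<open>0\<close> and \<open>s\<close>.\<close>

lemma poly_zero_free_const_abs:
  assumes "\<And>t. v t \<le> b \<Longrightarrow> poly q t \<noteq> 0" "v s \<le> b" "0 \<le> b"
  shows "v (poly q s) = v (poly q 0)"
proof -
  have "q \<noteq> 0" using assms by (metis poly_0)
  then show ?thesis using assms(1)
  proof (induction rule: poly_root_factor_induct)
    case (factor c q)
    have "\<not> v c \<le> b"
      using factor.prems[of c] by auto
    then have "v (s - c) = v c"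
      using v_diff_eq_max[of s c] assms(2) by auto
    moreover have "v (poly q s) = v (poly q 0)"
      using factor by force
    ultimately have "v (s - c) * v (poly q s) = v (0 - c) * v (poly q 0)"
      by simp
    then show ?case
      by (simp add: v_mult[symmetric] algebra_simps)
  qed simp
qed

text \<open>A Cauchy estimate: the difference quotient of \<open>q\<close> at \<open>0\<close> is a
  polynomial \<open>r\<close> with \<open>v t * v (poly r t) \<le> M\<close>, and the maximum
  principle bounds \<open>poly r 1\<close> by some \<open>poly r t\<close> with
  \<open>b / 2 < v t < b\<close>. Stopping at such a radius costs the factor 2.\<close>

lemma poly_lipschitz:
  assumes "\<And>t. v t \<le> b \<Longrightarrow> v (poly q t) \<le> M" "1 \<le> b"
  shows "v (poly q 1 - poly q 0) \<le> 2 * M / b"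
proof -
  have q1: "v (poly q 1 - poly q 0) \<le> M"
    using v_diff[of "poly q 1" "poly q 0"] assms(1)[of 1] assms(1)[of 0] assms(2) by auto
  have M: "0 \<le> M"
    using assms(1)[of 0] assms(2) v_nonneg[of "poly q 0"] unfolding v_zero by linarith
  show ?thesis
  \<comment> \<open>The maximum principle is applied with inner radius \<open>b / 2\<close>, which
    has to reach the point 1. For \<open>b \<le> 2\<close> the ultrametric bound \<open>M\<close> is
    already good enough.\<close>
  proof (cases "b \<le> 2")
    case True
    then have "M * b \<le> M * 2" using M by (intro mult_left_mono)
    then have "M \<le> 2 * M / b"
      using assms(2) by (simp add: field_simps)
    with q1 show ?thesis by linarith
  next
    case False
    have "poly (q - [:poly q 0:]) 0 = 0" by simp
    then obtain r where r: "q - [:poly q 0:] = [:0, 1:] * r"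
      by (metis poly_eq_0_iff_dvd dvdE minus_zero)
    have r': "poly q t - poly q 0 = t * poly r t" for t
      using arg_cong[OF r, of "\<lambda>p. poly p t"] by simp
    obtain t where t: "b / 2 < v t" "v t < b" "v (poly r 1) \<le> v (poly r t)"
      by (rule poly_max_principle[of "b/2" b r]) (use False in auto)
    have "v t * v (poly r t) \<le> M"
      using r'[of t] v_diff[of "poly q t" "poly q 0"] assms(1)[of t] assms(1)[of 0] t assms(2)
      by (auto simp flip: v_mult)
    then have "v (poly r t) \<le> M / v t"
      using t False by (subst pos_le_divide_eq) (auto simp: mult.commute)
    also have "\<dots> \<le> M / (b / 2)"
      using t M False by (intro divide_left_mono mult_pos_pos) linarith+
    finally show ?thesis
      using t(3) r'[of 1] by (simp add: mult.commute)
  qed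
qed

end

section \<open>Polynomial functions and the weak Nullstellensatz\<close>

text \<open>All variables \<open>x 0, x 1, \<dots>\<close> are allowed, so that their number is not a parameter.\<close>
inductive_set polyfuns :: "((nat \<Rightarrow> 'k::field) \<Rightarrow> 'k) set" where
  const: "(\<lambda>x. c) \<in> polyfuns"
| var: "(\<lambda>x. x i) \<in> polyfuns"
| add: "f \<in> polyfuns \<Longrightarrow> g \<in> polyfuns \<Longrightarrow> (\<lambda>x. f x + g x) \<in> polyfuns"
| mult: "f \<in> polyfuns \<Longrightarrow> g \<in> polyfuns \<Longrightarrow> (\<lambda>x. f x * g x) \<in> polyfuns"

lemma polyfuns_minus: "f \<in> polyfuns \<Longrightarrow> (\<lambda>x. - f x) \<in> polyfuns"
  using polyfuns.mult[OF polyfuns.const[of "-1"]] by simp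

lemma polyfuns_diff: "f \<in> polyfuns \<Longrightarrow> g \<in> polyfuns \<Longrightarrow> (\<lambda>x. f x - g x) \<in> polyfuns"
  using polyfuns.add[OF _ polyfuns_minus] by force

lemma polyfuns_power: "f \<in> polyfuns \<Longrightarrow> (\<lambda>x. f x ^ n) \<in> polyfuns"
  by (induction n) (auto intro: polyfuns.const polyfuns.mult)

lemma polyfuns_sum:
  "(\<And>i. i \<in> A \<Longrightarrow> f i \<in> polyfuns) \<Longrightarrow> (\<lambda>x. \<Sum>i\<in>A. f i x) \<in> polyfuns"
  by (induction A rule: infinite_finite_induct) (auto intro: polyfuns.const polyfuns.add)

lemma polyfuns_prod:
  "(\<And>i. i \<in> A \<Longrightarrow> f i \<in> polyfuns) \<Longrightarrow> (\<lambda>x. \<Prod>i\<in>A. f i x) \<in> polyfuns"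
  by (induction A rule: infinite_finite_induct) (auto intro: polyfuns.const polyfuns.mult)

lemma polyfuns_poly: "f \<in> polyfuns \<Longrightarrow> (\<lambda>x. poly q (f x)) \<in> polyfuns"
  by (induction q) (auto intro: polyfuns.const polyfuns.mult polyfuns.add)

lemmas polyfuns_intros = polyfuns.intros polyfuns_minus polyfuns_diff polyfuns_power
  polyfuns_sum polyfuns_prod polyfuns_poly

interpretation fun_vs: vector_space "\<lambda>(c::'k::field) (f :: 'b \<Rightarrow> 'k) x. c * f x"
  by standard (auto simp: fun_eq_iff algebra_simps)

text \<open>Lists of indices encode monomials, so the spanning family is countable. This is the
  countable dimension that is later played against an uncountable field.\<close>

lemma polyfuns_subset_span_monomials:
  "(polyfuns :: ((nat \<Rightarrow> 'k::field) \<Rightarrow> 'k) set) \<subseteq> fun_vs.span (range (\<lambda>is x. \<Prod>i\<leftarrow>is. x i))"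
    (is "_ \<subseteq> fun_vs.span (range ?m)")
proof
  fix f :: "(nat \<Rightarrow> 'k) \<Rightarrow> 'k" assume "f \<in> polyfuns"
  then show "f \<in> fun_vs.span (range ?m)"
  proof induction
    case (const c)
    have "?m [] \<in> fun_vs.span (range ?m)"
      by (intro fun_vs.span_base) blast
    from fun_vs.span_scale[OF this, of c] show ?case by simp
  next
    case (var i)
    have "?m [i] \<in> fun_vs.span (range ?m)"
      by (intro fun_vs.span_base) blast
    then show ?case by simp
  next
    case (add f g)
    then show ?case
      using fun_vs.span_add[of f _ g] by (simp add: plus_fun_def)
  next
    case (mult f g)
    have mono: "(\<lambda>x. ?m is x * g x) \<in> fun_vs.span (range ?m)" for "is"
      using \<open>g \<in> fun_vs.span _\<close>
    proof (induction rule: fun_vs.span_induct_alt)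
      case base
      then show ?case using fun_vs.span_zero[of "range ?m"] by (simp add: zero_fun_def)
    next
      case (step c b g)
      then obtain js where b: "b = ?m js" by auto
      have "?m (is @ js) \<in> fun_vs.span (range ?m)"
        by (intro fun_vs.span_base) blast
      from fun_vs.span_add[OF fun_vs.span_scale[OF this, of c] step.IH]
      show ?case by (simp add: b plus_fun_def algebra_simps)
    qed
    show ?case
      using \<open>f \<in> fun_vs.span _\<close>
    proof (induction rule: fun_vs.span_induct_alt)
      case base
      then show ?case using fun_vs.span_zero[of "range ?m"] by (simp add: zero_fun_def)
    next
      case (step c b f)
      then obtain js where b: "b = ?m js" by auto
      from fun_vs.span_add[OF fun_vs.span_scale[OF mono[of js], of c] step.IH]
      show ?case by (simp add: b plus_fun_def algebra_simps)
    qed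
  qed
qed

section \<open>Maximal ideals of the ring of polynomial functions\<close>

definition polyfun_ideal :: "((nat \<Rightarrow> 'k::field) \<Rightarrow> 'k) set \<Rightarrow> bool" where
  "polyfun_ideal I \<longleftrightarrow> I \<subseteq> polyfuns \<and> (\<lambda>x. 0) \<in> I \<and>
     (\<forall>f\<in>I. \<forall>g\<in>I. (\<lambda>x. f x + g x) \<in> I) \<and>
     (\<forall>f\<in>polyfuns. \<forall>g\<in>I. (\<lambda>x. f x * g x) \<in> I)"

definition proper_ideals :: "((nat \<Rightarrow> 'k::field) \<Rightarrow> 'k) set set" where
  "proper_ideals = {I. polyfun_ideal I \<and> (\<lambda>x. 1) \<notin> I}"

text \<open>Zorn's lemma applies to the proper ideals above \<open>I\<close>: if the union of a
  chain contained 1, so would one of its members.\<close>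

lemma ex_maximal_ideal:
  assumes "I \<in> proper_ideals"
  obtains M where "M \<in> proper_ideals" "I \<subseteq> M" "\<And>J. J \<in> proper_ideals \<Longrightarrow> M \<subseteq> J \<Longrightarrow> J = M"
proof -
  define \<A> where "\<A> = {J \<in> proper_ideals. I \<subseteq> J}"
  have "\<exists>M\<in>\<A>. \<forall>X\<in>\<A>. M \<subseteq> X \<longrightarrow> X = M"
  proof (rule subset_Zorn_nonempty)
    show "\<A> \<noteq> {}" using assms by (auto simp: \<A>_def)
    fix C assume "C \<noteq> {}" and C: "subset.chain \<A> C"
    then obtain J0 where J0: "J0 \<in> C" by blast
    have sub: "\<And>J. J \<in> C \<Longrightarrow> polyfun_ideal J \<and> (\<lambda>x. 1) \<notin> J \<and> I \<subseteq> J"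
      using C unfolding subset.chain_def \<A>_def proper_ideals_def by blast
    have lin: "\<And>J J'. J \<in> C \<Longrightarrow> J' \<in> C \<Longrightarrow> J \<subseteq> J' \<or> J' \<subseteq> J"
      using C unfolding subset.chain_def by blast
    have "(\<lambda>x. f x + g x) \<in> \<Union>C" if fg: "f \<in> \<Union>C" "g \<in> \<Union>C" for f g
    proof -
      obtain J J' where "J \<in> C" "J' \<in> C" "f \<in> J" "g \<in> J'"
        using fg by blast
      then obtain J'' where "J'' \<in> C" "f \<in> J''" "g \<in> J''"
        using lin by blast
      then show ?thesis
        using sub[of J''] unfolding polyfun_ideal_def by auto
    qed
    moreover have "\<Union>C \<subseteq> polyfuns"
      using sub unfolding polyfun_ideal_def by (intro Union_least) auto
    moreover have "(\<lambda>x. 1) \<notin> \<Union>C"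
      using sub by auto
    moreover have "(\<lambda>x. 0) \<in> \<Union>C" "I \<subseteq> \<Union>C"
      using sub[OF J0] J0 unfolding polyfun_ideal_def by auto
    moreover have "(\<lambda>x. f x * g x) \<in> \<Union>C" if "f \<in> polyfuns" "g \<in> \<Union>C" for f g
    proof -
      from that(2) obtain J where "J \<in> C" "g \<in> J" by blast
      then have "(\<lambda>x. f x * g x) \<in> J"
        using sub[of J] that(1) unfolding polyfun_ideal_def by auto
      with \<open>J \<in> C\<close> show ?thesis by blast
    qed
    ultimately show "\<Union>C \<in> \<A>"
      unfolding \<A>_def proper_ideals_def polyfun_ideal_def by auto
  qed
  then obtain M where M: "M \<in> \<A>" "\<And>X. X \<in> \<A> \<Longrightarrow> M \<subseteq> X \<Longrightarrow> X = M"
    by blast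
  show ?thesis
  proof (rule that[of M])
    show "M \<in> proper_ideals" "I \<subseteq> M"
      using M(1) by (auto simp: \<A>_def)
    then show "J = M" if "J \<in> proper_ideals" "M \<subseteq> J" for J
      using that by (intro M(2)) (auto simp: \<A>_def)
  qed
qed

locale maximal_polyfun_ideal =
  fixes M :: "((nat \<Rightarrow> 'k::field) \<Rightarrow> 'k) set"
  assumes proper: "M \<in> proper_ideals"
    and maximal: "\<And>J. J \<in> proper_ideals \<Longrightarrow> M \<subseteq> J \<Longrightarrow> J = M"
begin

lemma sub: "f \<in> M \<Longrightarrow> f \<in> polyfuns"
  and zero: "(\<lambda>x. 0) \<in> M"
  and add: "f \<in> M \<Longrightarrow> g \<in> M \<Longrightarrow> (\<lambda>x. f x + g x) \<in> M"
  and mult: "f \<in> polyfuns \<Longrightarrow> g \<in> M \<Longrightarrow> (\<lambda>x. f x * g x) \<in> M"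
  and one: "(\<lambda>x. 1) \<notin> M"
  using proper unfolding proper_ideals_def polyfun_ideal_def by auto

lemma diff: "f \<in> M \<Longrightarrow> g \<in> M \<Longrightarrow> (\<lambda>x. f x - g x) \<in> M"
  using add[of f "\<lambda>x. -1 * g x"] mult[OF polyfuns.const[of "-1"], of g] by simp

lemma sum: "(\<And>i. i \<in> A \<Longrightarrow> f i \<in> M) \<Longrightarrow> (\<lambda>x. \<Sum>i\<in>A. f i x) \<in> M"
  by (induction A rule: infinite_finite_induct) (auto intro: zero add)

lemma const_iff: "(\<lambda>x. c) \<in> M \<longleftrightarrow> c = 0"
  using mult[OF polyfuns.const[of "inverse c"], of "\<lambda>x. c"] one zero by (cases "c = 0") auto

text \<open>The quotient by a maximal ideal is a field: the ideal \<open>J\<close> generated by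
  \<open>M\<close> and \<open>f\<close> is strictly larger than \<open>M\<close>, so it contains
  1.\<close>

lemma inverse_mod:
  assumes "f \<in> polyfuns" "f \<notin> M"
  obtains h where "h \<in> polyfuns" "(\<lambda>x. h x * f x - 1) \<in> M"
proof -
  define J where "J = {(\<lambda>x. m x + h x * f x) | m h. m \<in> M \<and> h \<in> polyfuns}"
  have JI: "(\<lambda>x. m x + h x * f x) \<in> J" if "m \<in> M" "h \<in> polyfuns" for m h
    using that unfolding J_def by blast
  have "M \<subseteq> J"
    using JI[OF _ polyfuns.const[of 0]] by auto
  moreover have "f \<in> J"
    using JI[OF zero polyfuns.const[of 1]] by auto
  ultimately have "J \<notin> proper_ideals"
    using maximal assms(2) by blast
  moreover have "polyfun_ideal J"
    unfolding polyfun_ideal_def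
  proof (intro conjI ballI)
    show "J \<subseteq> polyfuns"
      unfolding J_def using assms(1) sub by (auto intro!: polyfuns.add[OF _ polyfuns.mult])
    show "(\<lambda>x. 0) \<in> J"
      using \<open>M \<subseteq> J\<close> zero by blast
  next
    fix g g' assume "g \<in> J" "g' \<in> J"
    then obtain m h m' h' where
      "g = (\<lambda>x. m x + h x * f x)" "m \<in> M" "h \<in> polyfuns"
      "g' = (\<lambda>x. m' x + h' x * f x)" "m' \<in> M" "h' \<in> polyfuns"
      unfolding J_def by blast
    then show "(\<lambda>x. g x + g' x) \<in> J"
      using JI[OF add[of m m'] polyfuns.add[of h h']] by (simp add: algebra_simps)
  next
    fix p g :: "(nat \<Rightarrow> 'k) \<Rightarrow> 'k" assume "p \<in> polyfuns" "g \<in> J"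
    then obtain m h where "g = (\<lambda>x. m x + h x * f x)" "m \<in> M" "h \<in> polyfuns"
      unfolding J_def by blast
    with \<open>p \<in> polyfuns\<close> show "(\<lambda>x. p x * g x) \<in> J"
      using JI[OF mult[of p m] polyfuns.mult[of p h]] by (simp add: algebra_simps)
  qed
  ultimately have "(\<lambda>x. 1) \<in> J"
    by (auto simp: proper_ideals_def)
  then obtain m h where mh: "m \<in> M" "h \<in> polyfuns" "(\<lambda>x. 1) = (\<lambda>x. m x + h x * f x)"
    unfolding J_def by blast
  have eq: "m x + h x * f x = 1" for x
    using fun_cong[OF mh(3), of x] by (rule sym)
  have "(\<lambda>x. h x * f x - (m x + h x * f x)) \<in> M"
    using diff[OF zero mh(1)] by simp
  then have "(\<lambda>x. h x * f x - 1) \<in> M"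
    unfolding eq .
  with mh(2) show ?thesis by (rule that)
qed

text \<open>If \<open>h\<close> inverts \<open>f\<close> modulo \<open>M\<close>, then
  \<open>g = h * (f * g) - g * (h * f - 1)\<close> lies in \<open>M\<close>.\<close>

lemma prime:
  assumes "f \<in> polyfuns" "g \<in> polyfuns" "(\<lambda>x. f x * g x) \<in> M"
  shows "f \<in> M \<or> g \<in> M"
proof (cases "f \<in> M")
  case False
  then obtain h where h: "h \<in> polyfuns" "(\<lambda>x. h x * f x - 1) \<in> M"
    using inverse_mod assms(1) by blast
  have "(\<lambda>x. h x * (f x * g x) - g x * (h x * f x - 1)) \<in> M"
    using diff[OF mult[OF h(1) assms(3)] mult[OF assms(2) h(2)]] by simp
  then show ?thesis by (simp add: algebra_simps)
qed simp

end

text \<open>If no \<open>x i - a\<close> lay in a maximal ideal \<open>M\<close>, then all \<open>x i - a\<close> would have inverses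
  \<open>h a\<close> modulo \<open>M\<close>. There are uncountably many of them in a space of countable dimension, so they
  satisfy a linear relation; clearing denominators turns it into a nonzero polynomial in
  \<open>x i\<close> that lies in \<open>M\<close>.\<close>
lemma (in maximal_polyfun_ideal) ex_coordinate:
  assumes closed: "alg_closed TYPE('k)"
    and uncountable: "uncountable (UNIV :: 'k set)"
  shows "\<exists>a. (\<lambda>x. x i - a) \<in> M"
proof (rule ccontr)
  assume none: "\<nexists>a. (\<lambda>x. x i - a) \<in> M"
  have lin: "(\<lambda>x. x i - a) \<in> polyfuns" for a :: 'k
    by (intro polyfuns_intros)
  \<comment> \<open>The class of \<open>x i\<close> is transcendental: splitting off a root
    \<open>a\<close> of \<open>q\<close>, primality of \<open>M\<close> would put either
    \<open>x i - a\<close> or a polynomial of smaller degree into \<open>M\<close>.\<close>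
  have no_poly: "(\<lambda>x :: nat \<Rightarrow> 'k. poly q (x i)) \<notin> M" if "q \<noteq> 0" for q :: "'k poly"
    using that
  proof (induction "degree q" arbitrary: q)
    case 0
    then obtain c where "q = [:c:]" by (metis degree_eq_zeroE)
    with 0 show ?case by (simp add: const_iff)
  next
    case (Suc n)
    then obtain a where "poly q a = 0"
      using closed unfolding alg_closed_def by (metis zero_less_Suc)
    then obtain r where r: "q = [:-a, 1:] * r"
      by (auto simp: poly_eq_0_iff_dvd)
    with Suc.prems have "r \<noteq> 0" by auto
    moreover have "degree q = Suc (degree r)"
      unfolding r using \<open>r \<noteq> 0\<close> by (subst degree_mult_eq) auto
    ultimately have "(\<lambda>x. poly r (x i)) \<notin> M"
      using Suc by auto
    moreover have "(\<lambda>x. poly q (x i)) = (\<lambda>x. (x i - a) * poly r (x i))"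
      by (auto simp: r algebra_simps)
    ultimately show ?case
      using prime[OF lin[of a] polyfuns_poly[OF polyfuns.var[of i], of r]] none by auto
  qed
  have "\<forall>a. \<exists>h. h \<in> polyfuns \<and> (\<lambda>x. h x * (x i - a) - 1) \<in> M"
    using inverse_mod[OF lin] none by blast
  from choice[OF this] obtain h where
    h: "\<And>a. h a \<in> polyfuns" "\<And>a. (\<lambda>x. h a x * (x i - a) - 1) \<in> M"
    by auto
  \<comment> \<open>If \<open>h a = h b\<close>, subtracting the two congruences puts
    \<open>(b - a) * h a\<close> into \<open>M\<close>, hence \<open>h a\<close>, hence 1.\<close>
  have "inj h"
  proof (rule injI, rule ccontr)
    fix a b assume eq: "h a = h b" and "a \<noteq> b"
    have "(\<lambda>x. (h a x * (x i - a) - 1) - (h b x * (x i - b) - 1)) \<in> M"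
      by (rule diff[OF h(2)[of a] h(2)[of b]])
    also have "(\<lambda>x. (h a x * (x i - a) - 1) - (h b x * (x i - b) - 1)) = (\<lambda>x. (b - a) * h a x)"
      unfolding eq by (rule ext) (simp add: algebra_simps)
    finally have "(\<lambda>x. (b - a) * h a x) \<in> M" .
    from mult[OF polyfuns.const[of "inverse (b - a)"] this] have "h a \<in> M"
      using \<open>a \<noteq> b\<close> by (simp flip: mult.assoc)
    from diff[OF mult[OF lin[of a] this] h(2)[of a]] have "(\<lambda>x. 1) \<in> M"
      by (simp add: mult.commute)
    then show False using one by simp
  qed
  define mono :: "nat list \<Rightarrow> (nat \<Rightarrow> 'k) \<Rightarrow> 'k" where "mono = (\<lambda>is x. \<Prod>i\<leftarrow>is. x i)"
  have "\<forall>a. \<exists>T. finite T \<and> T \<subseteq> range mono \<and> h a \<in> fun_vs.span T"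
  proof
    fix a
    have "h a \<in> fun_vs.span (range mono)"
      using h(1) polyfuns_subset_span_monomials unfolding mono_def by blast
    then obtain T r where "finite T" "T \<subseteq> range mono" "h a = (\<Sum>b\<in>T. (\<lambda>x. r b * b x))"
      by (auto simp: fun_vs.span_explicit)
    moreover from this(3) have "h a \<in> fun_vs.span T"
      by (simp only:) (rule fun_vs.span_sum, rule fun_vs.span_scale, rule fun_vs.span_base)
    ultimately show "\<exists>T. finite T \<and> T \<subseteq> range mono \<and> h a \<in> fun_vs.span T" by blast
  qed
  from choice[OF this] obtain T where
    T: "\<And>a. finite (T a)" "\<And>a. T a \<subseteq> range mono" "\<And>a. h a \<in> fun_vs.span (T a)"
    by auto
  have "countable (range T)"
    by (rule countable_subset[OF _ countable_Collect_finite_subset[of "range mono"]]) (use T in auto)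
  \<comment> \<open>Pigeonhole: uncountably many \<open>a\<close> share countably many finite sets
    of monomials, so infinitely many \<open>h a\<close> lie in the span of a single finite
    set.\<close>
  have "\<exists>U\<in>range T. infinite (T -` {U})"
  proof (rule ccontr)
    assume "\<not> ?thesis"
    then have "countable (\<Union>U\<in>range T. T -` {U})"
      using \<open>countable (range T)\<close> by (intro countable_UN) (auto intro: countable_finite)
    moreover have "(\<Union>U\<in>range T. T -` {U}) = UNIV" by auto
    ultimately show False using uncountable by simp
  qed
  then obtain b where inf: "infinite (T -` {T b})" by blast
  define H where "H = h ` (T -` {T b})"
  have "infinite H"
    unfolding H_def using inf \<open>inj h\<close> by (metis finite_imageD inj_on_subset subset_UNIV)
  moreover have "H \<subseteq> fun_vs.span (T b)"
  proof
    fix f assume "f \<in> H"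
    then obtain a where "T a = T b" "f = h a"
      by (auto simp: H_def)
    then show "f \<in> fun_vs.span (T b)"
      using T(3)[of a] by simp
  qed
  ultimately have "fun_vs.dependent H"
    using fun_vs.independent_span_bound[OF T(1)[of b]] by blast
  then obtain S' u where S': "finite S'" "S' \<subseteq> H" "(\<Sum>f\<in>S'. (\<lambda>x. u f * f x)) = 0" "\<exists>f\<in>S'. u f \<noteq> 0"
    unfolding fun_vs.dependent_explicit by blast
  define S where "S = h -` S'"
  have "h ` S = S'"
    using S'(2) unfolding S_def H_def by auto
  have fin: "finite S"
    unfolding S_def using S'(1) \<open>inj h\<close> by (rule finite_vimageI)
  define c where "c = u \<circ> h"
  have rel: "(\<Sum>a\<in>S. c a * h a x) = 0" for x
  proof -
    have "(\<Sum>a\<in>S. c a * h a x) = (\<Sum>f\<in>S'. u f * f x)"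
      unfolding \<open>h ` S = S'\<close>[symmetric] c_def
      using \<open>inj h\<close> by (subst sum.reindex) (auto intro: inj_on_subset)
    also have "\<dots> = (\<Sum>f\<in>S'. (\<lambda>x. u f * f x)) x"
      by (induction S' rule: infinite_finite_induct) auto
    finally show ?thesis using S'(3) by simp
  qed
  obtain a0 where a0: "a0 \<in> S" "c a0 \<noteq> 0"
    using S'(4) \<open>h ` S = S'\<close> by (auto simp: c_def)
  \<comment> \<open>The numerator of the sum of the fractions \<open>c a / (t - a)\<close> over the
    common denominator. At \<open>t = a0\<close> only the summand for \<open>a0\<close> survives, so
    \<open>q\<close> is not zero.\<close>
  define q where "q = (\<Sum>a\<in>S. smult (c a) (\<Prod>b\<in>S-{a}. [:-b, 1:]))"
  have q: "poly q t = (\<Sum>a\<in>S. c a * (\<Prod>b\<in>S-{a}. t - b))" for t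
    by (simp add: q_def poly_sum poly_prod)
  have "poly q a0 = c a0 * (\<Prod>b\<in>S-{a0}. a0 - b)"
  proof -
    have "(\<Sum>a\<in>S-{a0}. c a * (\<Prod>b\<in>S-{a}. a0 - b)) = 0"
    proof (intro sum.neutral ballI)
      fix a assume "a \<in> S - {a0}"
      then have "(\<Prod>b\<in>S-{a}. a0 - b) = 0"
        using a0 fin by (intro prod_zero) auto
      then show "c a * (\<Prod>b\<in>S-{a}. a0 - b) = 0" by simp
    qed
    then show ?thesis
      unfolding q using fin a0 by (simp add: sum.remove[of S a0])
  qed
  then have "q \<noteq> 0"
    using a0 fin by auto
  \<comment> \<open>Each congruence for \<open>h a\<close> is multiplied by its term of
    \<open>q\<close>. In the sum, the parts containing \<open>h a\<close> have the common factor
    \<open>\<Prod>b\<in>S. x i - b\<close> and cancel by \<open>rel\<close>, leaving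
    \<open>- poly q (x i)\<close>.\<close>
  have "(\<lambda>x. \<Sum>a\<in>S. (c a * (\<Prod>b\<in>S-{a}. x i - b)) * (h a x * (x i - a) - 1)) \<in> M"
    by (rule sum, rule mult[OF _ h(2)], intro polyfuns_intros)
  also have "(\<lambda>x. \<Sum>a\<in>S. (c a * (\<Prod>b\<in>S-{a}. x i - b)) * (h a x * (x i - a) - 1)) =
    (\<lambda>x. 0 - poly q (x i))"
  proof
    fix x :: "nat \<Rightarrow> 'k"
    have "(\<Sum>a\<in>S. (c a * (\<Prod>b\<in>S-{a}. x i - b)) * (h a x * (x i - a) - 1)) =
      (\<Sum>a\<in>S. (c a * h a x) * ((x i - a) * (\<Prod>b\<in>S-{a}. x i - b))) - poly q (x i)"
      unfolding q sum_subtractf[symmetric] by (intro sum.cong) (auto simp: algebra_simps)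
    also have "(\<Sum>a\<in>S. (c a * h a x) * ((x i - a) * (\<Prod>b\<in>S-{a}. x i - b))) =
      (\<Sum>a\<in>S. (c a * h a x) * (\<Prod>b\<in>S. x i - b))"
      using fin by (intro sum.cong) (auto simp: prod.remove)
    also have "\<dots> = 0"
      using rel[of x] by (simp flip: sum_distrib_right)
    finally show "(\<Sum>a\<in>S. (c a * (\<Prod>b\<in>S-{a}. x i - b)) * (h a x * (x i - a) - 1)) =
      0 - poly q (x i)" .
  qed
  finally have "(\<lambda>x. 0 - (0 - poly q (x i))) \<in> M"
    using diff zero by blast
  then show False using no_poly[OF \<open>q \<noteq> 0\<close>] by simp
qed

text \<open>Modulo a maximal ideal \<open>M\<close> above \<open>I\<close> every coordinate is
  congruent to a constant \<open>a i\<close>, so every \<open>f\<close> is congruent to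
  \<open>f a\<close>. For \<open>f\<close> in \<open>I\<close> the constant \<open>f a\<close> lies
  in \<open>M\<close> and must vanish.\<close>

lemma weak_nullstellensatz:
  fixes I :: "((nat \<Rightarrow> 'k::field) \<Rightarrow> 'k) set"
  assumes "alg_closed TYPE('k)" "uncountable (UNIV :: 'k set)"
    and "polyfun_ideal I" "(\<lambda>x. 1) \<notin> I"
  obtains a where "\<And>f. f \<in> I \<Longrightarrow> f a = 0"
proof -
  obtain M where M: "M \<in> proper_ideals" "I \<subseteq> M"
      "\<And>J. J \<in> proper_ideals \<Longrightarrow> M \<subseteq> J \<Longrightarrow> J = M"
    using ex_maximal_ideal[of I] assms(3,4) unfolding proper_ideals_def by blast
  interpret maximal_polyfun_ideal M
    by standard (use M in auto)
  obtain a where a: "\<And>i. (\<lambda>x. x i - a i) \<in> M"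
    using ex_coordinate[OF assms(1,2)] by metis
  have eval: "(\<lambda>x. f x - f a) \<in> M" if "f \<in> polyfuns" for f
    using that
  proof induction
    case (const c)
    then show ?case using zero by simp
  next
    case (var i)
    then show ?case by (rule a)
  next
    case (add f g)
    from maximal_polyfun_ideal.add[OF maximal_polyfun_ideal_axioms add.IH]
    show ?case by (simp add: algebra_simps)
  next
    case (mult f g)
    from maximal_polyfun_ideal.add[OF maximal_polyfun_ideal_axioms
        maximal_polyfun_ideal.mult[OF maximal_polyfun_ideal_axioms mult.hyps(1) mult.IH(2)]
        maximal_polyfun_ideal.mult[OF maximal_polyfun_ideal_axioms polyfuns.const[of "g a"] mult.IH(1)]]
    show ?case by (simp add: algebra_simps)
  qed
  have "f a = 0" if "f \<in> I" for f
  proof -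
    have "f \<in> M" using that M by auto
    from diff[OF this eval[OF sub[OF this]]] show ?thesis
      by (simp add: const_iff)
  qed
  then show ?thesis by (rule that)
qed

section \<open>Projective space and the chordal metric\<close>

abbreviation nonzero_vec :: "nat \<Rightarrow> (nat \<Rightarrow> 'k::field) \<Rightarrow> bool" where
  "nonzero_vec N x \<equiv> x \<in> kvec N \<and> x \<noteq> (\<lambda>_. 0)"

lemma PN_E:
  assumes "P \<in> PN N"
  obtains x where "nonzero_vec N x" "P = proj N x"
  using assms unfolding PN_def by blast

lemma proj_in_PN: "nonzero_vec N x \<Longrightarrow> proj N x \<in> PN N"
  unfolding PN_def by blast

lemma proj_scale:
  assumes "c \<noteq> 0"
  shows "proj N (\<lambda>i. c * x i) = proj N x"
proof -
  have "(\<exists>a. a \<noteq> 0 \<and> y = (\<lambda>i. a * (c * x i))) \<longleftrightarrow> (\<exists>a. a \<noteq> 0 \<and> y = (\<lambda>i. a * x i))" for y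
  proof (rule iffI; elim exE conjE)
    fix a assume a: "a \<noteq> 0" and y: "y = (\<lambda>i. a * (c * x i))"
    have "y = (\<lambda>i. (a * c) * x i)"
      unfolding y by (rule ext, rule mult.assoc[symmetric])
    moreover have "a * c \<noteq> 0"
      using a assms by (rule no_zero_divisors)
    ultimately show "\<exists>a. a \<noteq> 0 \<and> y = (\<lambda>i. a * x i)"
      by (intro exI conjI)
  next
    fix a assume a: "a \<noteq> 0" and y: "y = (\<lambda>i. a * x i)"
    have "a * x i = (a / c) * (c * x i)" for i
      using assms by (metis mult.assoc nonzero_eq_divide_eq)
    then have "y = (\<lambda>i. (a / c) * (c * x i))"
      unfolding y by (rule ext)
    moreover have "a / c \<noteq> 0"
      using a assms by (metis divide_eq_0_iff)
    ultimately show "\<exists>a. a \<noteq> 0 \<and> y = (\<lambda>i. a * (c * x i))"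
      by (intro exI conjI)
  qed
  then show ?thesis
    unfolding proj_def by (simp only:)
qed

text \<open>The arbitrary choice made by \<open>rep\<close> is known up to a nonzero scalar only;
  homogeneity then allows passing to any other lift.\<close>

lemma rep_proj:
  assumes "nonzero_vec N x"
  obtains c where "c \<noteq> 0" "rep (proj N x) = (\<lambda>i. c * x i)"
proof -
  have "x \<in> proj N x"
    unfolding proj_def using assms by (auto intro!: exI[of _ 1])
  then have "rep (proj N x) \<in> proj N x"
    unfolding rep_def by (rule someI[of "\<lambda>y. y \<in> proj N x"])
  then show ?thesis
    using that unfolding proj_def by blast
qed

context nonarch
begin

lemma v_le_vnorm: "i \<le> N \<Longrightarrow> v (x i) \<le> vnorm v N x"
  unfolding vnorm_def by (intro Max_ge) auto

lemma vnorm_le_iff: "vnorm v N x \<le> B \<longleftrightarrow> (\<forall>i\<le>N. v (x i) \<le> B)"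
  unfolding vnorm_def by (subst Max_le_iff) auto

lemma vnorm_attained: obtains i where "i \<le> N" "v (x i) = vnorm v N x"
proof -
  have "vnorm v N x \<in> (\<lambda>i. v (x i)) ` {..N}"
    unfolding vnorm_def by (intro Max_in) auto
  then show ?thesis using that by auto
qed

lemma vnorm_nonneg [simp]: "0 \<le> vnorm v N x"
  using v_le_vnorm[of 0 N x] v_nonneg[of "x 0"] by linarith

lemma vnorm_scale: "vnorm v N (\<lambda>i. c * x i) = v c * vnorm v N x"
proof (rule antisym)
  show "vnorm v N (\<lambda>i. c * x i) \<le> v c * vnorm v N x"
    unfolding vnorm_le_iff by (auto simp: v_mult intro: mult_left_mono v_le_vnorm)
  obtain i where "i \<le> N" "v (x i) = vnorm v N x" by (rule vnorm_attained)
  then show "v c * vnorm v N x \<le> vnorm v N (\<lambda>i. c * x i)"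
    using v_le_vnorm[of i N "\<lambda>i. c * x i"] by (simp add: v_mult)
qed

lemma vnorm_pos: "nonzero_vec N x \<Longrightarrow> 0 < vnorm v N x"
proof -
  assume x: "nonzero_vec N x"
  then obtain i where "x i \<noteq> 0" by auto
  moreover from this x have "i \<le> N"
    unfolding kvec_def by (auto simp: not_le[symmetric])
  ultimately show ?thesis
    using v_le_vnorm[of i N x] v_pos_iff[of "x i"] by linarith
qed

lemma chordal_vec_le_iff:
  assumes "0 < vnorm v N x" "0 < vnorm v N y"
  shows "chordal_vec v N x y \<le> r \<longleftrightarrow>
    (\<forall>i\<le>N. \<forall>j\<le>N. v (x i * y j - x j * y i) \<le> r * (vnorm v N x * vnorm v N y))"
  unfolding chordal_vec_def using assms by (subst pos_divide_le_eq) (auto simp: Max_le_iff)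

lemma chordal_vec_scale:
  assumes "nonzero_vec N x" "nonzero_vec N y" "a \<noteq> 0" "b \<noteq> 0"
  shows "chordal_vec v N (\<lambda>i. a * x i) (\<lambda>i. b * y i) = chordal_vec v N x y"
proof -
  \<comment> \<open>Equality is obtained by showing that both numbers have the same upper bounds
    \<open>r\<close>, which turns maxima into inequalities for single minors.\<close>
  have "chordal_vec v N (\<lambda>i. a * x i) (\<lambda>i. b * y i) \<le> r \<longleftrightarrow> chordal_vec v N x y \<le> r" for r
  proof -
    have *: "a * x i * (b * y j) - a * x j * (b * y i) = (a * b) * (x i * y j - x j * y i)" for i j
      by (simp add: algebra_simps)
    have "v ((a * b) * D) \<le> r * (v a * vnorm v N x * (v b * vnorm v N y)) \<longleftrightarrow>
        v D \<le> r * (vnorm v N x * vnorm v N y)" for D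
    proof -
      have "r * (v a * vnorm v N x * (v b * vnorm v N y)) =
          (v a * v b) * (r * (vnorm v N x * vnorm v N y))"
        by (simp only: mult_ac)
      then show ?thesis
        using assms(3,4) mult_le_cancel_left_pos[of "v a * v b"] by (simp only: v_mult) simp
    qed
    then show ?thesis
      using assms by (simp add: chordal_vec_le_iff vnorm_pos vnorm_scale *)
  qed
  from this[of "chordal_vec v N x y"] this[of "chordal_vec v N (\<lambda>i. a * x i) (\<lambda>i. b * y i)"]
  show ?thesis by simp
qed

lemma chordal_proj:
  assumes "nonzero_vec N x" "nonzero_vec N y"
  shows "chordal v N (proj N x) (proj N y) = chordal_vec v N x y"
proof -
  obtain a where "a \<noteq> 0" "rep (proj N x) = (\<lambda>i. a * x i)"
    using rep_proj assms(1) by blast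
  moreover obtain b where "b \<noteq> 0" "rep (proj N y) = (\<lambda>i. b * y i)"
    using rep_proj assms(2) by blast
  ultimately show ?thesis
    using chordal_vec_scale[OF assms] by (simp add: chordal_def)
qed

lemma v_le_chordal_vec:
  assumes "nonzero_vec N x" "nonzero_vec N y" "i \<le> N" "j \<le> N"
  shows "v (x i * y j - x j * y i) \<le> chordal_vec v N x y * (vnorm v N x * vnorm v N y)"
  using iffD1[OF chordal_vec_le_iff[OF vnorm_pos[OF assms(1)] vnorm_pos[OF assms(2)]] order_refl]
    assms(3,4) by blast

lemma chordal_vec_self:
  assumes "nonzero_vec N x"
  shows "chordal_vec v N x x \<le> 0"
  using assms by (simp add: chordal_vec_le_iff vnorm_pos mult.commute)

lemma chordal_vec_commute:
  assumes "nonzero_vec N x" "nonzero_vec N y"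
  shows "chordal_vec v N y x \<le> chordal_vec v N x y"
  unfolding chordal_vec_le_iff[OF vnorm_pos[OF assms(2)] vnorm_pos[OF assms(1)]]
  using v_le_chordal_vec[OF assms] by (metis mult.commute)

text \<open>The Pluecker identity
  \<open>y i * (x a * z b - x b * z a) = z b * (x a * y i - x i * y a) - z a * (x b * y i - x i * y b)
    + x i * (y a * z b - y b * z a)\<close>, applied to an index \<open>i\<close> with \<open>\<bar>y i\<bar> = \<parallel>y\<parallel>\<close>.\<close>
lemma chordal_vec_ultrametric:
  assumes x: "nonzero_vec N x" and y: "nonzero_vec N y" and z: "nonzero_vec N z"
  shows "chordal_vec v N x z \<le> max (chordal_vec v N x y) (chordal_vec v N y z)"
proof -
  define r where "r = max (chordal_vec v N x y) (chordal_vec v N y z)"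
  define nx ny nz where "nx = vnorm v N x" and "ny = vnorm v N y" and "nz = vnorm v N z"
  have pos: "0 < nx" "0 < ny" "0 < nz"
    using assms by (auto simp: nx_def ny_def nz_def vnorm_pos)
  have xy: "v (x a * y b - x b * y a) \<le> r * (nx * ny)" if "a \<le> N" "b \<le> N" for a b
    using chordal_vec_le_iff[of N x y r] pos that by (auto simp: nx_def ny_def r_def)
  have yz: "v (y a * z b - y b * z a) \<le> r * (ny * nz)" if "a \<le> N" "b \<le> N" for a b
    using chordal_vec_le_iff[of N y z r] pos that by (auto simp: nz_def ny_def r_def)
  obtain i where i: "i \<le> N" "v (y i) = ny"
    unfolding ny_def by (rule vnorm_attained)
  have "v (x a * z b - x b * z a) \<le> r * (nx * nz)" if ab: "a \<le> N" "b \<le> N" for a b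
  proof -
    define B where "B = ny * (r * (nx * nz))"
    have le: "v (s * t) \<le> B" if "v s \<le> p" "v t \<le> q" "p * q = B" for s t p q
      using mult_mono[of "v s" p "v t" q] that v_nonneg[of s] v_nonneg[of t]
      by (simp add: v_mult)
    have "nz * (r * (nx * ny)) = B" "nx * (r * (ny * nz)) = B"
      by (simp_all add: B_def)
    note le = le[OF _ _ this(1)] le[OF _ _ this(2)]
    have "v (z b * (x a * y i - x i * y a)) \<le> B" "v (z a * (x b * y i - x i * y b)) \<le> B"
      using v_le_vnorm[of _ N z] xy ab i(1) by (auto intro!: le(1) simp: nz_def)
    moreover have "v (x i * (y a * z b - y b * z a)) \<le> B"
      using v_le_vnorm[of i N x] yz ab i(1) by (auto intro!: le(2) simp: nx_def)
    moreover have "y i * (x a * z b - x b * z a) = (z b * (x a * y i - x i * y a)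
        - z a * (x b * y i - x i * y b)) + x i * (y a * z b - y b * z a)"
      by (simp add: algebra_simps)
    ultimately have "v (y i * (x a * z b - x b * z a)) \<le> B"
      using v_add[of "z b * (x a * y i - x i * y a) - z a * (x b * y i - x i * y b)"
          "x i * (y a * z b - y b * z a)"]
        v_diff[of "z b * (x a * y i - x i * y a)" "z a * (x b * y i - x i * y b)"]
      by auto
    then show ?thesis
      using pos i by (simp add: v_mult B_def)
  qed
  then show ?thesis
    using pos unfolding r_def[symmetric] by (subst chordal_vec_le_iff) (auto simp: nx_def nz_def)
qed

lemma chordal_commute_le:
  assumes "P \<in> PN N" "Q \<in> PN N"
  shows "chordal v N Q P \<le> chordal v N P Q"
proof -
  obtain x y where "nonzero_vec N x" "P = proj N x" "nonzero_vec N y" "Q = proj N y"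
    using assms by (meson PN_E)
  then show ?thesis
    using chordal_vec_commute[of x N y] by (simp add: chordal_proj)
qed

lemma chordal_commute:
  "P \<in> PN N \<Longrightarrow> Q \<in> PN N \<Longrightarrow> chordal v N Q P = chordal v N P Q"
  by (simp add: antisym chordal_commute_le)

lemma chordal_ultrametric:
  assumes "P \<in> PN N" "Q \<in> PN N" "R \<in> PN N"
  shows "chordal v N P R \<le> max (chordal v N P Q) (chordal v N Q R)"
proof -
  obtain x y z where "nonzero_vec N x" "P = proj N x" "nonzero_vec N y" "Q = proj N y"
    "nonzero_vec N z" "R = proj N z"
    using assms by (meson PN_E)
  then show ?thesis
    using chordal_vec_ultrametric[of x N y z] by (simp add: chordal_proj)
qed

lemma chordal_self: "P \<in> PN N \<Longrightarrow> chordal v N P P \<le> 0"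
  using chordal_vec_self by (auto elim!: PN_E simp: chordal_proj)

text \<open>Otherwise, for \<open>j\<close> with \<open>v (y j) = vnorm v N y\<close>, the product
  \<open>x i * y j\<close> strictly dominates \<open>x j * y i\<close>. That minor then has the full
  size \<open>vnorm v N x * vnorm v N y\<close>, which makes the distance at least 1.\<close>

lemma dominant_index:
  assumes x: "nonzero_vec N x" and y: "nonzero_vec N y" and "chordal_vec v N x y < 1"
    and i: "i \<le> N" "v (x i) = vnorm v N x"
  shows "v (y i) = vnorm v N y"
proof (rule ccontr)
  assume "v (y i) \<noteq> vnorm v N y"
  then have less: "v (y i) < vnorm v N y"
    using v_le_vnorm[of i N y] i by simp
  obtain j where j: "j \<le> N" "v (y j) = vnorm v N y" by (rule vnorm_attained)
  have pos: "0 < vnorm v N x" "0 < vnorm v N y"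
    using x y by (auto simp: vnorm_pos)
  have xj: "v (x j) \<le> vnorm v N x" using j by (intro v_le_vnorm)
  have "v (x j) * v (y i) \<le> vnorm v N x * v (y i)"
    using xj by (intro mult_right_mono) auto
  also have "\<dots> < vnorm v N x * vnorm v N y"
    using less pos by simp
  finally have "v (x j * y i) < v (x i * y j)"
    by (simp add: v_mult i j)
  then have "v (x i * y j - x j * y i) = vnorm v N x * vnorm v N y"
    by (subst v_diff_eq_max) (auto simp: v_mult i j)
  moreover have "\<dots> > chordal_vec v N x y * (vnorm v N x * vnorm v N y)"
    using assms(3) pos by simp
  ultimately show False
    using v_le_chordal_vec[OF x y i(1) j(1)] by simp
qed

text \<open>Normalized lifts of the points at which the \<open>i\<close>-th coordinate is dominant.\<close>
definition unit_chart :: "nat \<Rightarrow> nat \<Rightarrow> (nat \<Rightarrow> 'k) set" where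
  "unit_chart N i = {y \<in> kvec N. y i = 1 \<and> vnorm v N y = 1}"

lemma unit_chart_nonzero: "y \<in> unit_chart N i \<Longrightarrow> nonzero_vec N y"
  unfolding unit_chart_def by auto

lemma normalize:
  assumes x: "nonzero_vec N x" and i: "i \<le> N" "v (x i) = vnorm v N x"
  obtains y where "y \<in> unit_chart N i" "x = (\<lambda>j. x i * y j)" "x i \<noteq> 0"
proof -
  have xi: "x i \<noteq> 0" using i vnorm_pos[OF x] by auto
  define y where "y = (\<lambda>j. inverse (x i) * x j)"
  have "y \<in> unit_chart N i"
    using x xi i(2)[symmetric] unfolding unit_chart_def y_def
    by (simp add: vnorm_scale v_inverse kvec_def)
  moreover have "x = (\<lambda>j. x i * y j)"
    using xi by (auto simp: y_def)
  ultimately show ?thesis using xi that by blast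
qed

lemma PN_unit_chart:
  assumes "P \<in> PN N"
  obtains i p where "i \<le> N" "p \<in> unit_chart N i" "P = proj N p"
proof -
  obtain x where x: "nonzero_vec N x" "P = proj N x"
    using assms by (rule PN_E)
  obtain i where i: "i \<le> N" "v (x i) = vnorm v N x" by (rule vnorm_attained)
  obtain y where "y \<in> unit_chart N i" "x = (\<lambda>j. x i * y j)" "x i \<noteq> 0"
    by (rule normalize[OF x(1) i])
  then show ?thesis using that[OF i(1)] proj_scale x(2) by metis
qed

text \<open>The dominant index persists within distance less than 1, so a single chart serves a
  whole ball.\<close>

lemma PN_near_unit_chart:
  assumes "p \<in> unit_chart N i" "i \<le> N" "Q \<in> PN N" "chordal v N (proj N p) Q < 1"
  obtains y where "y \<in> unit_chart N i" "Q = proj N y"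
proof -
  obtain x where x: "nonzero_vec N x" "Q = proj N x"
    using assms(3) by (rule PN_E)
  have "chordal_vec v N p x < 1"
    using assms(4) x unit_chart_nonzero[OF assms(1)] by (simp add: chordal_proj)
  moreover have "v (p i) = vnorm v N p"
    using assms(1) by (simp add: unit_chart_def)
  ultimately have "v (x i) = vnorm v N x"
    using dominant_index[OF unit_chart_nonzero[OF assms(1)] x(1)] assms(2) by blast
  then obtain y where "y \<in> unit_chart N i" "x = (\<lambda>j. x i * y j)" "x i \<noteq> 0"
    using normalize[OF x(1) assms(2)] by blast
  then show ?thesis using that proj_scale x(2) by metis
qed

text \<open>The minors with second index \<open>i\<close> are the differences
  \<open>y j - z j\<close>; every other minor is a combination of two such differences with
  coefficients of absolute value at most 1.\<close>

lemma chordal_unit_chart: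
  assumes y: "y \<in> unit_chart N i" and z: "z \<in> unit_chart N i" and i: "i \<le> N"
  shows "chordal v N (proj N y) (proj N z) = vnorm v N (\<lambda>j. y j - z j)"
proof -
  have n: "vnorm v N y = 1" "vnorm v N z = 1" "y i = 1" "z i = 1"
    using y z by (auto simp: unit_chart_def)
  have "chordal_vec v N y z \<le> vnorm v N (\<lambda>j. y j - z j)"
  proof (subst chordal_vec_le_iff, simp_all add: n, intro allI impI)
    fix a b assume ab: "a \<le> N" "b \<le> N"
    have le: "v (s * t) \<le> vnorm v N (\<lambda>j. y j - z j)" if "v s \<le> 1" "v t \<le> vnorm v N (\<lambda>j. y j - z j)" for s t
      using mult_mono[of "v s" 1 "v t" "vnorm v N (\<lambda>j. y j - z j)"] that by (simp add: v_mult)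
    have "v (y b * (y a - z a)) \<le> vnorm v N (\<lambda>j. y j - z j)"
      "v (y a * (y b - z b)) \<le> vnorm v N (\<lambda>j. y j - z j)"
      using ab v_le_vnorm[of _ N y] v_le_vnorm[of _ N "\<lambda>j. y j - z j"] by (auto intro!: le simp: n)
    moreover have "y a * z b - y b * z a = y b * (y a - z a) - y a * (y b - z b)"
      by (simp add: algebra_simps)
    ultimately show "v (y a * z b - y b * z a) \<le> vnorm v N (\<lambda>j. y j - z j)"
      using v_diff[of "y b * (y a - z a)" "y a * (y b - z b)"] by auto
  qed
  moreover have "vnorm v N (\<lambda>j. y j - z j) \<le> chordal_vec v N y z"
    unfolding vnorm_le_iff
    using v_le_chordal_vec[OF unit_chart_nonzero[OF y] unit_chart_nonzero[OF z] _ i] by (auto simp: n)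
  ultimately show ?thesis
    using y z by (simp add: chordal_proj unit_chart_nonzero)
qed

text \<open>This reduces several variables to one: the line through two close points of a chart
  stays in it for a parameter disc whose radius is the inverse of their distance.\<close>

lemma unit_chart_line:
  assumes y: "y \<in> unit_chart N i" and z: "z \<in> unit_chart N i" and i: "i \<le> N"
    and "v t * vnorm v N (\<lambda>j. z j - y j) \<le> 1"
  shows "(\<lambda>j. y j + t * (z j - y j)) \<in> unit_chart N i"
proof -
  have "vnorm v N (\<lambda>j. t * (z j - y j)) \<le> 1"
    using assms(4) by (simp add: vnorm_scale)
  then have "vnorm v N (\<lambda>j. y j + t * (z j - y j)) \<le> 1"
    using y unfolding vnorm_le_iff unit_chart_def
    by (auto intro!: order_trans[OF v_add] order_trans[OF v_le_vnorm])
  moreover have "1 \<le> vnorm v N (\<lambda>j. y j + t * (z j - y j))"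
    using v_le_vnorm[OF i, of "\<lambda>j. y j + t * (z j - y j)"] y z by (simp add: unit_chart_def)
  ultimately show ?thesis
    using y z by (auto simp: unit_chart_def kvec_def)
qed

section \<open>Bounds, substitution and restriction to lines for polynomial functions\<close>

lemma polyfun_bounded:
  assumes "f \<in> polyfuns"
  shows "\<exists>B. \<forall>x. (\<forall>k. v (x k) \<le> 1) \<longrightarrow> v (f x) \<le> B"
  using assms
proof induction
  case (const c)
  then show ?case by (intro exI[of _ "v c"]) simp
next
  case (var i)
  then show ?case by (intro exI[of _ 1]) simp
next
  case (add f g)
  then obtain B C where "\<forall>x. (\<forall>k. v (x k) \<le> 1) \<longrightarrow> v (f x) \<le> B" "\<forall>x. (\<forall>k. v (x k) \<le> 1) \<longrightarrow> v (g x) \<le> C"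
    by blast
  then show ?case
    by (intro exI[of _ "max B C"] allI impI order_trans[OF v_add] max.mono) auto
next
  case (mult f g)
  then obtain B C where "\<forall>x. (\<forall>k. v (x k) \<le> 1) \<longrightarrow> v (f x) \<le> B" "\<forall>x. (\<forall>k. v (x k) \<le> 1) \<longrightarrow> v (g x) \<le> C"
    by blast
  then show ?case
    by (intro exI[of _ "B * C"] allI impI)
      (auto simp: v_mult intro!: mult_mono intro: order_trans[OF v_nonneg])
qed

end

lemma polyfun_compose:
  assumes "f \<in> polyfuns" "\<And>j. (\<lambda>x. g x j) \<in> polyfuns"
  shows "(\<lambda>x. f (g x)) \<in> polyfuns"
  using assms(1)
proof induction
  case (var i)
  then show ?case by (rule assms(2))
qed (auto intro: polyfuns.const polyfuns.add polyfuns.mult)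

lemma polyfun_line:
  assumes "f \<in> polyfuns"
  obtains q where "\<And>t. f (\<lambda>j. y j + t * w j) = poly q t"
proof -
  have "\<exists>q. \<forall>t. f (\<lambda>j. y j + t * w j) = poly q t"
    using assms
  proof induction
    case (const c)
    show ?case by (rule exI[of _ "[:c:]"]) simp
  next
    case (var i)
    show ?case by (rule exI[of _ "[:y i, w i:]"]) simp
  next
    case (add f g)
    then show ?case by (metis poly_add)
  next
    case (mult f g)
    then show ?case by (metis poly_mult)
  qed
  then show ?thesis using that by blast
qed

section \<open>Lifts and Green functions\<close>

lemma eval_poly_scale:
  assumes "homog_poly N d c"
  shows "eval_poly N c (\<lambda>i. b * x i) = b ^ d * eval_poly N c x"
proof -
  have "c a * (\<Prod>i\<le>N. (b * x i) ^ a i) = b ^ d * (c a * (\<Prod>i\<le>N. x i ^ a i))" if "c a \<noteq> 0" for a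
  proof -
    have "(\<Prod>i\<le>N. b ^ a i) = b ^ d"
      using assms that unfolding homog_poly_def by (metis power_sum)
    then show ?thesis
      by (simp add: power_mult_distrib prod.distrib)
  qed
  then show ?thesis
    unfolding eval_poly_def sum_distrib_left by (intro sum.cong) auto
qed

lemma eval_map_polyfun: "(\<lambda>x. eval_map N Phi x j) \<in> polyfuns"
  unfolding eval_map_def eval_poly_def by (cases "j \<le> N") (simp_all add: polyfuns_intros)

lemma eval_map_funpow_polyfun: "(\<lambda>x. (eval_map N Phi ^^ n) x j) \<in> polyfuns"
proof (induction n arbitrary: j)
  case 0
  then show ?case by (simp add: polyfuns.var)
next
  case (Suc n)
  show ?case
    using polyfun_compose[OF eval_map_polyfun Suc.IH] by simp
qed

text \<open>The set of all \<open>f\<close> which on the affine chart \<open>x i = 1\<close> are combinations of the \<open>Phi j\<close>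
  is an ideal without common zero.\<close>
lemma nullstellensatz_chart:
  fixes Phi :: "nat \<Rightarrow> (nat \<Rightarrow> nat) \<Rightarrow> 'k::field"
  assumes "alg_closed TYPE('k)" "uncountable (UNIV :: 'k set)"
    and nonvanishing: "\<And>x. nonzero_vec N x \<Longrightarrow> eval_map N Phi x \<noteq> (\<lambda>_. 0)"
  obtains g where "\<And>j. g j \<in> polyfuns"
    "\<And>x. x \<in> kvec N \<Longrightarrow> x i = 1 \<Longrightarrow> (\<Sum>j\<le>N. g j x * eval_map N Phi x j) = 1"
proof -
  define I where "I = {f \<in> polyfuns. \<exists>g. (\<forall>j. g j \<in> polyfuns) \<and>
    (\<forall>x\<in>kvec N. x i = 1 \<longrightarrow> f x = (\<Sum>j\<le>N. g j x * eval_map N Phi x j))}"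
  have I: "f \<in> I" if "f \<in> polyfuns" "\<And>j. g j \<in> polyfuns"
    "\<And>x. x \<in> kvec N \<Longrightarrow> x i = 1 \<Longrightarrow> f x = (\<Sum>j\<le>N. g j x * eval_map N Phi x j)" for f g
    unfolding I_def using that by blast
  have "polyfun_ideal I"
    unfolding polyfun_ideal_def
  proof (intro conjI ballI)
    show "I \<subseteq> polyfuns" by (auto simp: I_def)
    show "(\<lambda>x. 0) \<in> I"
      by (rule I[of _ "\<lambda>_ _. 0"]) (auto intro: polyfuns.const)
  next
    fix f f' :: "(nat \<Rightarrow> 'k) \<Rightarrow> 'k" assume "f \<in> I" "f' \<in> I"
    obtain g where "f \<in> polyfuns" "\<forall>j. g j \<in> polyfuns"
      "\<forall>x\<in>kvec N. x i = 1 \<longrightarrow> f x = (\<Sum>j\<le>N. g j x * eval_map N Phi x j)"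
      using \<open>f \<in> I\<close> unfolding I_def by blast
    moreover obtain g' where "f' \<in> polyfuns" "\<forall>j. g' j \<in> polyfuns"
      "\<forall>x\<in>kvec N. x i = 1 \<longrightarrow> f' x = (\<Sum>j\<le>N. g' j x * eval_map N Phi x j)"
      using \<open>f' \<in> I\<close> unfolding I_def by blast
    ultimately show "(\<lambda>x. f x + f' x) \<in> I"
      by (intro I[of _ "\<lambda>j x. g j x + g' j x"] polyfuns.add)
        (simp_all add: sum.distrib distrib_right)
  next
    fix p f :: "(nat \<Rightarrow> 'k) \<Rightarrow> 'k" assume "p \<in> polyfuns" "f \<in> I"
    then obtain g where "p \<in> polyfuns" "f \<in> polyfuns" "\<forall>j. g j \<in> polyfuns"
      "\<forall>x\<in>kvec N. x i = 1 \<longrightarrow> f x = (\<Sum>j\<le>N. g j x * eval_map N Phi x j)"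
      unfolding I_def by blast
    then show "(\<lambda>x. p x * f x) \<in> I"
      by (intro I[of _ "\<lambda>j x. p x * g j x"] polyfuns.mult)
        (simp_all add: sum_distrib_left mult.assoc)
  qed
  moreover have "\<exists>f\<in>I. f a \<noteq> 0" for a
  proof (rule ccontr)
    assume "\<not> ?thesis"
    then have zero: "f a = 0" if "f \<in> I" for f
      using that by blast
    \<comment> \<open>Functions vanishing on the chart belong to \<open>I\<close> with all
      coefficients zero. This forces a common zero of \<open>I\<close> to satisfy
      \<open>a i = 1\<close> and to lie in \<open>kvec N\<close>.\<close>
    have "(\<lambda>x. x i - 1) \<in> I"
      by (rule I[of _ "\<lambda>_ _. 0"]) (auto intro: polyfuns_intros)
    then have "a i = 1" using zero by force
    have "a k = 0" if "k > N" for k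
    proof -
      have "(\<lambda>x. x k) \<in> I"
        by (rule I[of _ "\<lambda>_ _. 0"]) (use that in \<open>auto intro: polyfuns.const polyfuns.var simp: kvec_def\<close>)
      then show ?thesis using zero by force
    qed
    with \<open>a i = 1\<close> have "nonzero_vec N a"
      by (auto simp: kvec_def)
    then have "eval_map N Phi a \<noteq> (\<lambda>_. 0)"
      by (rule nonvanishing)
    moreover have "eval_map N Phi a j = 0" for j
    proof (cases "j \<le> N")
      case True
      have "(\<lambda>x. eval_map N Phi x j) \<in> I"
      proof (rule I[of _ "\<lambda>k x. if k = j then 1 else 0"])
        show "(\<lambda>x. if k = j then 1 else 0) \<in> polyfuns" for k
          by (rule polyfuns.const)
        show "eval_map N Phi x j = (\<Sum>k\<le>N. (if k = j then 1 else 0) * eval_map N Phi x k)" for x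
          using True by (simp add: if_distrib[of "\<lambda>c. c * _"] sum.delta cong: if_cong)
      qed (rule eval_map_polyfun)
      then show ?thesis using zero by force
    qed (simp add: eval_map_def)
    ultimately show False by auto
  qed
  ultimately have "(\<lambda>x. 1) \<in> I"
    using weak_nullstellensatz[OF assms(1,2), of I] by metis
  then obtain g where g: "\<And>j. g j \<in> polyfuns"
    "\<And>x. x \<in> kvec N \<Longrightarrow> x i = 1 \<Longrightarrow> 1 = (\<Sum>j\<le>N. g j x * eval_map N Phi x j)"
    unfolding I_def by auto
  show ?thesis
    by (rule that[OF g(1)]) (use g(2) in \<open>auto simp: eq_commute[of 1]\<close>)
qed

section \<open>Growth of the iterates of a lift\<close>

locale nonarch_dynamics = alg_closed_nonarch v for v :: "'k::field \<Rightarrow> real" +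
  fixes N d :: nat and Phi :: "nat \<Rightarrow> (nat \<Rightarrow> nat) \<Rightarrow> 'k"
    and phi :: "(nat \<Rightarrow> 'k) set \<Rightarrow> (nat \<Rightarrow> 'k) set"
  assumes complete: "complete_abs v" and d: "2 \<le> d" and lift: "is_lift N d Phi phi"
begin

abbreviation F :: "(nat \<Rightarrow> 'k) \<Rightarrow> (nat \<Rightarrow> 'k)" where
  "F \<equiv> eval_map N Phi"

lemma F_nonzero: "nonzero_vec N x \<Longrightarrow> nonzero_vec N (F x)"
  using lift unfolding is_lift_def by (auto simp: kvec_def eval_map_def)

lemma Fn_nonzero: "nonzero_vec N x \<Longrightarrow> nonzero_vec N ((F ^^ n) x)"
  by (induction n) (simp_all add: F_nonzero)

lemma F_scale: "F (\<lambda>i. c * x i) = (\<lambda>i. c ^ d * F x i)"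
proof
  fix i show "F (\<lambda>i. c * x i) i = c ^ d * F x i"
    using lift unfolding is_lift_def eval_map_def by (simp add: eval_poly_scale[of N d])
qed

lemma Fn_scale: "(F ^^ n) (\<lambda>i. c * x i) = (\<lambda>i. c ^ (d ^ n) * (F ^^ n) x i)"
proof (induction n)
  case (Suc n)
  have "(F ^^ Suc n) (\<lambda>i. c * x i) = F (\<lambda>i. c ^ (d ^ n) * (F ^^ n) x i)"
    by (simp only: funpow.simps comp_def Suc.IH)
  also have "\<dots> = (\<lambda>i. (c ^ (d ^ n)) ^ d * F ((F ^^ n) x) i)"
    by (rule F_scale)
  finally show ?case
    by (simp add: power_mult[symmetric] mult.commute)
qed simp

lemma phi_iterate:
  assumes "nonzero_vec N x"
  shows "(phi ^^ n) (proj N x) = proj N ((F ^^ n) x)"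
proof (induction n)
  case (Suc n)
  then show ?case
    using lift Fn_nonzero[OF assms, of n] unfolding is_lift_def by simp
qed simp

text \<open>The upper bound is the boundedness of polynomial functions on the unit polydisc. For the
  lower bound, the identity \<open>1 = (\<Sum>j\<le>N. g j u * F u j)\<close> with bounded
  \<open>g j\<close> keeps the \<open>F u j\<close> from being small all at once.\<close>

lemma vnorm_F_bounds:
  obtains A B where "0 < A" "\<And>i u. i \<le> N \<Longrightarrow> u \<in> unit_chart N i \<Longrightarrow> A \<le> vnorm v N (F u)"
    "\<And>i u. i \<le> N \<Longrightarrow> u \<in> unit_chart N i \<Longrightarrow> vnorm v N (F u) \<le> B"
proof -
  have unit: "v (u k) \<le> 1" if "u \<in> unit_chart N i" for u i k
    using that v_le_vnorm[of k N u] unfolding unit_chart_def kvec_def by (cases "k \<le> N") auto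
  have "\<exists>B. \<forall>x. (\<forall>k. v (x k) \<le> 1) \<longrightarrow> v (F x j) \<le> B" for j
    by (rule polyfun_bounded[OF eval_map_polyfun])
  then obtain B where B: "\<And>j x. (\<And>k. v (x k) \<le> 1) \<Longrightarrow> v (F x j) \<le> B j"
    by metis
  have upper: "vnorm v N (F u) \<le> Max (B ` {..N})" if u: "u \<in> unit_chart N i" for u i
    unfolding vnorm_le_iff
  proof (intro allI impI)
    fix k assume "k \<le> N"
    then have "B k \<le> Max (B ` {..N})" by (intro Max_ge) auto
    moreover have "v (F u k) \<le> B k" by (rule B[OF unit[OF u]])
    ultimately show "v (F u k) \<le> Max (B ` {..N})" by linarith
  qed
  have "\<exists>A>0. \<forall>u\<in>unit_chart N i. A \<le> vnorm v N (F u)" for i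
  proof -
    obtain g where g: "\<And>j. g j \<in> polyfuns"
      "\<And>x. x \<in> kvec N \<Longrightarrow> x i = 1 \<Longrightarrow> (\<Sum>j\<le>N. g j x * F x j) = 1"
      by (rule nullstellensatz_chart[OF closed uncountable_complete[OF complete], of N Phi i])
        (use lift in \<open>auto simp: is_lift_def\<close>)
    have "\<exists>B. \<forall>x. (\<forall>k. v (x k) \<le> 1) \<longrightarrow> v (g j x) \<le> B" for j
      by (rule polyfun_bounded[OF g(1)])
    then obtain C where C: "\<And>j x. (\<And>k. v (x k) \<le> 1) \<Longrightarrow> v (g j x) \<le> C j"
      by metis
    define c where "c = max 1 (Max (C ` {..N}))"
    have "1 / c \<le> vnorm v N (F u)" if u: "u \<in> unit_chart N i" for u
    proof -
      have "v (g j u * F u j) \<le> c * vnorm v N (F u)" if "j \<le> N" for j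
      proof -
        have "v (g j u) \<le> C j" using C unit[OF u] by blast
        also have "\<dots> \<le> c" unfolding c_def using that by (intro max.coboundedI2 Max_ge) auto
        finally show ?thesis
          unfolding v_mult using v_le_vnorm[OF that, of "F u"]
          by (intro mult_mono) (auto simp: c_def)
      qed
      then have "v (\<Sum>j\<le>N. g j u * F u j) \<le> c * vnorm v N (F u)"
        by (intro v_sum_le) (auto simp: c_def)
      then have "1 \<le> c * vnorm v N (F u)"
        using g(2)[of u] u by (simp add: unit_chart_def)
      then show ?thesis
        by (subst pos_divide_le_eq) (auto simp: c_def mult.commute)
    qed
    moreover have "0 < 1 / c" by (simp add: c_def)
    ultimately show ?thesis by blast
  qed
  then obtain A where A: "\<And>i. 0 < A i" "\<And>i u. u \<in> unit_chart N i \<Longrightarrow> A i \<le> vnorm v N (F u)"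
    by metis
  have "0 < Min (A ` {..N})"
    using A(1) by (subst Min_gr_iff) auto
  moreover have "Min (A ` {..N}) \<le> vnorm v N (F u)" if "i \<le> N" "u \<in> unit_chart N i" for i u
    using A(2)[OF that(2)] that(1) by (meson Min_le order_trans finite_atMost finite_imageI image_eqI atMost_iff)
  ultimately show ?thesis
    using upper that by blast
qed

text \<open>By homogeneity, passing to a normalized lift \<open>u\<close> accounts for exactly
  \<open>d * ln (vnorm v N x)\<close>; what remains is \<open>ln (vnorm v N (F u))\<close>.\<close>

lemma ln_vnorm_F:
  obtains C where "0 \<le> C"
    "\<And>x. nonzero_vec N x \<Longrightarrow> \<bar>ln (vnorm v N (F x)) - d * ln (vnorm v N x)\<bar> \<le> C"
proof -
  obtain A B where AB: "0 < A" "\<And>i u. i \<le> N \<Longrightarrow> u \<in> unit_chart N i \<Longrightarrow> A \<le> vnorm v N (F u)"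
    "\<And>i u. i \<le> N \<Longrightarrow> u \<in> unit_chart N i \<Longrightarrow> vnorm v N (F u) \<le> B"
    by (rule vnorm_F_bounds) blast
  define C where "C = max \<bar>ln A\<bar> \<bar>ln B\<bar>"
  have "\<bar>ln (vnorm v N (F x)) - d * ln (vnorm v N x)\<bar> \<le> C" if x: "nonzero_vec N x" for x
  proof -
    obtain i where i: "i \<le> N" "v (x i) = vnorm v N x" by (rule vnorm_attained)
    obtain u where u: "u \<in> unit_chart N i" "x = (\<lambda>j. x i * u j)" "x i \<noteq> 0"
      by (rule normalize[OF x i])
    have "F x = (\<lambda>j. x i ^ d * F u j)"
      by (subst u(2)) (rule F_scale)
    then have "vnorm v N (F x) = v (x i) ^ d * vnorm v N (F u)"
      by (simp add: vnorm_scale v_power)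
    moreover have pos: "0 < vnorm v N (F u)"
      using AB(1) AB(2)[OF i(1) u(1)] by linarith
    ultimately have "ln (vnorm v N (F x)) = d * ln (vnorm v N x) + ln (vnorm v N (F u))"
      using vnorm_pos[OF x] i(2) by (simp add: ln_mult ln_realpow)
    moreover have "ln A \<le> ln (vnorm v N (F u))" "ln (vnorm v N (F u)) \<le> ln B"
      using AB(1) AB(2,3)[OF i(1) u(1)] pos by auto
    ultimately show ?thesis by (simp add: C_def)
  qed
  moreover have "0 \<le> C" by (simp add: C_def)
  ultimately show ?thesis using that by blast
qed

text \<open>The quotients \<open>a n\<close> move by at most \<open>C / d ^ Suc n\<close> in step
  \<open>n\<close>. As \<open>d \<ge> 2\<close>, the intervals of radius \<open>C / d ^ n\<close>
  around \<open>a n\<close> are nested, so the limit lies in each of them; multiplying by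
  \<open>d ^ n\<close> gives a bound uniform in \<open>x\<close> and \<open>n\<close>.\<close>

lemma green_estimate:
  obtains C where "0 \<le> C"
    "\<And>x. nonzero_vec N x \<Longrightarrow>
      (\<lambda>n. ln (vnorm v N ((F ^^ n) x)) / real d ^ n) \<longlonglongrightarrow> green v N d Phi x"
    "\<And>x n. nonzero_vec N x \<Longrightarrow>
      \<bar>ln (vnorm v N ((F ^^ n) x)) - real d ^ n * green v N d Phi x\<bar> \<le> C"
proof -
  obtain C where C: "0 \<le> C"
    "\<And>x. nonzero_vec N x \<Longrightarrow> \<bar>ln (vnorm v N (F x)) - d * ln (vnorm v N x)\<bar> \<le> C"
    by (rule ln_vnorm_F) blast
  have dpos: "0 < real d ^ n" for n using d by simp
  have both: "(\<lambda>n. ln (vnorm v N ((F ^^ n) x)) / real d ^ n) \<longlonglongrightarrow> green v N d Phi x \<and>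
      (\<forall>n. \<bar>ln (vnorm v N ((F ^^ n) x)) - real d ^ n * green v N d Phi x\<bar> \<le> C)"
    if x: "nonzero_vec N x" for x
  proof -
    define a where "a = (\<lambda>n. ln (vnorm v N ((F ^^ n) x)) / real d ^ n)"
    define e where "e = (\<lambda>n. C / real d ^ n)"
    have a_step: "\<bar>a (Suc n) - a n\<bar> \<le> e (Suc n)" for n
    proof -
      have "a (Suc n) - a n = (ln (vnorm v N (F ((F ^^ n) x))) - d * ln (vnorm v N ((F ^^ n) x))) / real d ^ Suc n"
        using d by (simp add: a_def field_simps)
      then show ?thesis
        using C(2)[OF Fn_nonzero[OF x, of n]] dpos[of "Suc n"]
        by (simp add: e_def abs_divide divide_right_mono)
    qed
    have e_step: "2 * e (Suc n) \<le> e n" for n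
    proof -
      have "2 * e (Suc n) = (2 / d) * e n"
        by (simp add: e_def)
      also have "\<dots> \<le> 1 * e n"
        using d C(1) by (intro mult_right_mono) (auto simp: e_def)
      finally show ?thesis by simp
    qed
    have e_lim: "e \<longlonglongrightarrow> 0"
      unfolding e_def using d by (intro LIMSEQ_divide_realpow_zero) auto
    have e_nonneg: "0 \<le> e n" for n
      using C(1) by (simp add: e_def)
    have "\<exists>l. ((\<forall>n. a n - e n \<le> l) \<and> (\<lambda>n. a n - e n) \<longlonglongrightarrow> l) \<and>
        ((\<forall>n. l \<le> a n + e n) \<and> (\<lambda>n. a n + e n) \<longlonglongrightarrow> l)"
    proof (intro nested_sequence_unique allI)
      fix n
      show "a n - e n \<le> a (Suc n) - e (Suc n)" "a (Suc n) + e (Suc n) \<le> a n + e n"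
        using a_step[of n] e_step[of n] by linarith+
      show "a n - e n \<le> a n + e n" using e_nonneg[of n] by linarith
    next
      have "(\<lambda>n. - 2 * e n) \<longlonglongrightarrow> - 2 * 0"
        by (intro tendsto_mult tendsto_const e_lim)
      then show "(\<lambda>n. a n - e n - (a n + e n)) \<longlonglongrightarrow> 0" by simp
    qed
    then obtain l where l: "\<And>n. a n - e n \<le> l" "\<And>n. l \<le> a n + e n" "(\<lambda>n. a n - e n) \<longlonglongrightarrow> l"
      by blast
    have "(\<lambda>n. (a n - e n) + e n) \<longlonglongrightarrow> l + 0"
      by (intro tendsto_add l e_lim)
    then have lim: "a \<longlonglongrightarrow> l" by simp
    then have green: "green v N d Phi x = l"
      unfolding green_def a_def by (rule limI)
    have "\<bar>ln (vnorm v N ((F ^^ n) x)) - real d ^ n * l\<bar> \<le> C" for n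
    proof -
      have "\<bar>a n - l\<bar> \<le> e n" using l(1)[of n] l(2)[of n] by linarith
      then have "real d ^ n * \<bar>a n - l\<bar> \<le> C"
        using dpos[of n] by (simp add: e_def pos_le_divide_eq mult.commute)
      moreover have "ln (vnorm v N ((F ^^ n) x)) - real d ^ n * l = real d ^ n * (a n - l)"
        using dpos[of n] d by (simp add: a_def algebra_simps)
      ultimately show ?thesis
        using dpos[of n] by (simp add: abs_mult)
    qed
    with lim green show ?thesis by (simp add: a_def)
  qed
  show ?thesis
    by (rule that[OF C(1)]) (use both in blast)+
qed

lemma green_scale:
  assumes x: "nonzero_vec N x" and c: "c \<noteq> 0"
  shows "green v N d Phi (\<lambda>i. c * x i) = green v N d Phi x + ln (v c)"
proof -
  have lim: "(\<lambda>n. ln (vnorm v N ((F ^^ n) x)) / real d ^ n) \<longlonglongrightarrow> green v N d Phi x"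
    by (rule green_estimate) (use x in blast)
  have "ln (vnorm v N ((F ^^ n) (\<lambda>i. c * x i))) / real d ^ n =
      ln (vnorm v N ((F ^^ n) x)) / real d ^ n + ln (v c)" for n
    using vnorm_pos[OF Fn_nonzero[OF x, of n]] c d
    by (simp add: Fn_scale vnorm_scale v_power ln_mult ln_realpow add_divide_distrib)
  then have "(\<lambda>n. ln (vnorm v N ((F ^^ n) (\<lambda>i. c * x i))) / real d ^ n) \<longlonglongrightarrow>
      green v N d Phi x + ln (v c)"
    using lim by (auto intro!: tendsto_intros)
  then show ?thesis
    unfolding green_def by (rule limI)
qed

text \<open>The terms \<open>ln (v c)\<close> from the Green function and from the norm cancel, so
  any lift may replace the chosen representative.\<close>

lemma green_hat_proj:
  assumes "nonzero_vec N x"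
  shows "green_hat v N d Phi (proj N x) = green v N d Phi x - ln (vnorm v N x)"
proof -
  obtain c where c: "c \<noteq> 0" "rep (proj N x) = (\<lambda>i. c * x i)"
    using rep_proj assms by blast
  then show ?thesis
    using assms vnorm_pos[OF assms]
    by (simp add: green_hat_def green_scale vnorm_scale ln_mult)
qed

lemma green_hat_chart:
  "u \<in> unit_chart N i \<Longrightarrow> green_hat v N d Phi (proj N u) = green v N d Phi u"
  by (simp add: green_hat_proj unit_chart_nonzero) (simp add: unit_chart_def)

section \<open>The three equivalent conditions\<close>

text \<open>Near an equicontinuity point the images under an iterate stay at chordal distance less than
  \<open>1\<close>, so they share a dominant coordinate. This coordinate is a polynomial without zeros along
  lines of the chart, hence of constant absolute value.\<close>
lemma equicont_imp_green_hat_const: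
  assumes P: "P \<in> PN N" and "equicont_at v N phi P"
  shows "\<exists>r>0. \<forall>Q\<in>PN N. chordal v N P Q < r \<longrightarrow> green_hat v N d Phi Q = green_hat v N d Phi P"
proof -
  obtain \<delta> where \<delta>: "0 < \<delta>" "\<And>n Q. n \<ge> 1 \<Longrightarrow> Q \<in> PN N \<Longrightarrow> chordal v N P Q < \<delta> \<Longrightarrow>
      chordal v N ((phi ^^ n) P) ((phi ^^ n) Q) < 1"
    using assms(2) unfolding equicont_at_def by (metis zero_less_one)
  obtain i p where i: "i \<le> N" and p: "p \<in> unit_chart N i" and Pp: "P = proj N p"
    using P by (rule PN_unit_chart)
  have "green_hat v N d Phi Q = green_hat v N d Phi P"
    if Q: "Q \<in> PN N" "chordal v N P Q < min \<delta> 1" for Q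
  proof -
    obtain y where y: "y \<in> unit_chart N i" and Qy: "Q = proj N y"
      using PN_near_unit_chart[OF p i Q(1)] Q(2) Pp by auto
    define w where "w = (\<lambda>t j. p j + t * (y j - p j))"
    have dist: "vnorm v N (\<lambda>j. y j - p j) < min \<delta> 1"
      using Q(2) chordal_unit_chart[OF y p i] chordal_commute[OF P Q(1)] Pp Qy by simp
    have w: "w t \<in> unit_chart N i" "chordal v N P (proj N (w t)) < \<delta>" if t: "v t \<le> 1" for t
    proof -
      have le: "v t * vnorm v N (\<lambda>j. y j - p j) \<le> vnorm v N (\<lambda>j. y j - p j)"
        using mult_right_mono[OF t, of "vnorm v N (\<lambda>j. y j - p j)"] by simp
      then show wt: "w t \<in> unit_chart N i"
        unfolding w_def using dist by (intro unit_chart_line[OF p y i]) linarith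
      have "chordal v N (proj N (w t)) P = vnorm v N (\<lambda>j. t * (y j - p j))"
        unfolding Pp chordal_unit_chart[OF wt p i] by (simp add: w_def)
      then show "chordal v N P (proj N (w t)) < \<delta>"
        using le dist chordal_commute[OF proj_in_PN[OF unit_chart_nonzero[OF wt]] P]
        by (simp add: vnorm_scale)
    qed
    have "vnorm v N ((F ^^ n) y) = vnorm v N ((F ^^ n) p)" for n
    \<comment> \<open>Equicontinuity only speaks about \<open>n \<ge> 1\<close>; for
      \<open>n = 0\<close> both norms are 1 by normalization.\<close>
    proof (cases "n = 0")
      case True
      then show ?thesis using p y by (simp add: unit_chart_def)
    next
      case False
      obtain k where k: "k \<le> N" "v ((F ^^ n) p k) = vnorm v N ((F ^^ n) p)"
        by (rule vnorm_attained)
      have dom: "v ((F ^^ n) (w t) k) = vnorm v N ((F ^^ n) (w t))" if t: "v t \<le> 1" for t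
      proof (rule dominant_index[OF _ _ _ k])
        note nz = unit_chart_nonzero[OF p] unit_chart_nonzero[OF w(1)[OF t]]
        show "nonzero_vec N ((F ^^ n) p)" "nonzero_vec N ((F ^^ n) (w t))"
          using Fn_nonzero nz by blast+
        then show "chordal_vec v N ((F ^^ n) p) ((F ^^ n) (w t)) < 1"
          using \<delta>(2)[of n "proj N (w t)"] False w(2)[OF t] proj_in_PN[OF nz(2)]
          by (simp add: Pp phi_iterate nz chordal_proj)
      qed
      obtain q where q: "\<And>t. (F ^^ n) (w t) k = poly q t"
        unfolding w_def
        using polyfun_line[OF eval_map_funpow_polyfun[where N = N and Phi = Phi and n = n and j = k], of p "\<lambda>j. y j - p j"] by metis
      have "poly q t \<noteq> 0" if t: "v t \<le> 1" for t
        using dom[OF t] vnorm_pos[OF Fn_nonzero[OF unit_chart_nonzero[OF w(1)[OF t]], of n]]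
        unfolding q by auto
      then have "v (poly q 1) = v (poly q 0)"
        by (rule poly_zero_free_const_abs[of 1]) auto
      then have "vnorm v N ((F ^^ n) (w 1)) = vnorm v N ((F ^^ n) (w 0))"
        using dom[of 1] dom[of 0] by (simp add: q)
      then show ?thesis by (simp add: w_def)
    qed
    then have "green v N d Phi y = green v N d Phi p"
      by (simp add: green_def)
    then show ?thesis
      using p y by (simp add: Pp Qy green_hat_chart)
  qed
  then show ?thesis
    using \<delta>(1) by (intro exI[of _ "min \<delta> 1"]) auto
qed

text \<open>Where the Green function is constant, \<open>\<parallel>F\<^sup>n\<parallel>\<close> is constant up to bounded factors, and a
  polynomial map that is bounded on a polydisc is Lipschitz there.\<close>
lemma green_hat_const_imp_lipschitz:
  assumes P: "P \<in> PN N" and "0 < r0"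
    and const: "\<And>Q. Q \<in> PN N \<Longrightarrow> chordal v N P Q < r0 \<Longrightarrow>
      green_hat v N d Phi Q = green_hat v N d Phi P"
  shows "\<exists>r>0. \<exists>C>0. \<forall>Q\<in>closed_disk v N P r. \<forall>R\<in>closed_disk v N P r. \<forall>n.
    chordal v N ((phi ^^ n) Q) ((phi ^^ n) R) \<le> C * chordal v N Q R"
proof -
  \<comment> \<open>Halving \<open>r0\<close> lets the closed disk fit into the open ball where the
    Green function is constant; the bound \<open>1 / 2\<close> keeps the disk inside one
    chart.\<close>
  define r where "r = min (r0 / 2) (1 / 2)"
  have r: "0 < r" "r < 1" "r < r0" using \<open>0 < r0\<close> by (auto simp: r_def)
  obtain B where B: "\<And>x n. nonzero_vec N x \<Longrightarrow>
      \<bar>ln (vnorm v N ((F ^^ n) x)) - real d ^ n * green v N d Phi x\<bar> \<le> B"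
    by (rule green_estimate) blast
  obtain i p where i: "i \<le> N" and p: "p \<in> unit_chart N i" and Pp: "P = proj N p"
    using P by (rule PN_unit_chart)
  define g where "g = green_hat v N d Phi P"
  define T where "T = (\<lambda>n. exp (real d ^ n * g))"
  have bounds: "exp (- B) * T n \<le> vnorm v N ((F ^^ n) y)" "vnorm v N ((F ^^ n) y) \<le> exp B * T n"
    if y: "y \<in> unit_chart N i" "chordal v N P (proj N y) \<le> r" for y n
  proof -
    have "green v N d Phi y = g"
      using const[OF proj_in_PN[OF unit_chart_nonzero[OF y(1)]]] y r
      by (simp add: g_def green_hat_chart)
    then have "\<bar>ln (vnorm v N ((F ^^ n) y)) - real d ^ n * g\<bar> \<le> B"
      using B[OF unit_chart_nonzero[OF y(1)], of n] by simp
    moreover have "exp (ln (vnorm v N ((F ^^ n) y))) = vnorm v N ((F ^^ n) y)"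
      using vnorm_pos[OF Fn_nonzero[OF unit_chart_nonzero[OF y(1)], of n]] by simp
    ultimately show "exp (- B) * T n \<le> vnorm v N ((F ^^ n) y)" "vnorm v N ((F ^^ n) y) \<le> exp B * T n"
      unfolding T_def by (metis abs_le_iff exp_add exp_le_cancel_iff add.commute diff_le_eq
          minus_diff_eq neg_le_iff_le minus_le_iff le_diff_eq uminus_add_conv_diff)+
  qed
  \<comment> \<open>The factor \<open>2 / r\<close> comes from the Cauchy estimate. The factor
    \<open>exp (4 * B)\<close> is the squared ratio of the upper and lower bounds for the norm of
    the iterate, in which \<open>T n\<close> cancels.\<close>
  define C where "C = 2 * exp (4 * B) / r"
  have C: "0 < C" using r by (simp add: C_def)
  have "chordal v N ((phi ^^ n) Q) ((phi ^^ n) R) \<le> C * chordal v N Q R"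
    if QR: "Q \<in> closed_disk v N P r" "R \<in> closed_disk v N P r" for Q R n
  proof -
    have QP: "Q \<in> PN N" "R \<in> PN N" "chordal v N P Q \<le> r" "chordal v N P R \<le> r"
      using QR by (auto simp: closed_disk_def)
    obtain y where y: "y \<in> unit_chart N i" and Qy: "Q = proj N y"
      using PN_near_unit_chart[OF p i QP(1)] QP(3) Pp r by auto
    obtain z where z: "z \<in> unit_chart N i" and Rz: "R = proj N z"
      using PN_near_unit_chart[OF p i QP(2)] QP(4) Pp r by auto
    define \<epsilon> where "\<epsilon> = vnorm v N (\<lambda>j. z j - y j)"
    have \<epsilon>: "chordal v N Q R = \<epsilon>"
      using chordal_unit_chart[OF z y i] chordal_commute[OF QP(1,2)] by (simp add: Qy Rz \<epsilon>_def)
    have "\<epsilon> \<le> r"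
      using chordal_ultrametric[OF QP(1) P QP(2)] chordal_commute[OF P QP(1)] QP \<epsilon> by auto
    define X Y where "X = (F ^^ n) y" and "Y = (F ^^ n) z"
    have nz: "nonzero_vec N X" "nonzero_vec N Y"
      unfolding X_def Y_def using y z by (auto intro!: Fn_nonzero dest: unit_chart_nonzero)
    have phi: "chordal v N ((phi ^^ n) Q) ((phi ^^ n) R) = chordal_vec v N X Y"
      using nz by (simp add: Qy Rz phi_iterate unit_chart_nonzero[OF y] unit_chart_nonzero[OF z]
          X_def Y_def chordal_proj)
    have "chordal_vec v N X Y \<le> C * \<epsilon>"
    proof (cases "\<epsilon> = 0")
      case True
      have "z j = y j" for j
      proof (cases "j \<le> N")
        case True
        with \<open>\<epsilon> = 0\<close> show ?thesis
          using v_le_vnorm[of j N "\<lambda>j. z j - y j"] v_nonneg[of "z j - y j"]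
          unfolding \<epsilon>_def by (metis antisym eq_iff_diff_eq_0 v_eq_0_iff)
      next
        case False
        then show ?thesis using y z by (simp add: unit_chart_def kvec_def)
      qed
      then have "z = y" by blast
      then show ?thesis
        using True chordal_vec_self[OF nz(1)] by (simp add: X_def Y_def)
    next
      case False
      then have \<epsilon>pos: "0 < \<epsilon>"
        by (simp add: \<epsilon>_def less_le)
      \<comment> \<open>The line runs from \<open>y\<close> at \<open>t = 0\<close> to
        \<open>z\<close> at \<open>t = 1\<close> and stays in the disk up to
        \<open>v t \<le> r / \<epsilon>\<close>. This large radius puts the factor
        \<open>\<epsilon>\<close> into the Lipschitz bound.\<close>
      define w where "w = (\<lambda>t j. y j + t * (z j - y j))"
      have w: "w t \<in> unit_chart N i" "chordal v N P (proj N (w t)) \<le> r" if t: "v t \<le> r / \<epsilon>" for t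
      proof -
        have le: "v t * \<epsilon> \<le> r"
          using t \<epsilon>pos by (simp add: pos_le_divide_eq)
        then show wt: "w t \<in> unit_chart N i"
          unfolding w_def using r by (intro unit_chart_line[OF y z i]) (simp add: \<epsilon>_def)
        have wPN: "proj N (w t) \<in> PN N"
          by (rule proj_in_PN[OF unit_chart_nonzero[OF wt]])
        have "chordal v N (proj N (w t)) Q = vnorm v N (\<lambda>j. t * (z j - y j))"
          unfolding Qy chordal_unit_chart[OF wt y i] by (simp add: w_def)
        then have "chordal v N Q (proj N (w t)) \<le> r"
          using le chordal_commute[OF wPN QP(1)] by (simp add: vnorm_scale \<epsilon>_def)
        then show "chordal v N P (proj N (w t)) \<le> r"
          using chordal_ultrametric[OF P QP(1) wPN] QP(3) by auto
      qed
      define M where "M = exp B * T n"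
      have T: "0 < T n" by (simp add: T_def)
      have lip: "v (Y j - X j) \<le> 2 * M * \<epsilon> / r" if j: "j \<le> N" for j
      proof -
        obtain q where q: "\<And>t. (F ^^ n) (w t) j = poly q t"
          unfolding w_def
          using polyfun_line[OF eval_map_funpow_polyfun[where N = N and Phi = Phi and n = n and j = j], of y "\<lambda>j. z j - y j"] by metis
        have "v (poly q t) \<le> M" if t: "v t \<le> r / \<epsilon>" for t
          using bounds(2)[OF w[OF t], of n] v_le_vnorm[OF j, of "(F ^^ n) (w t)"]
          unfolding q[symmetric] M_def by linarith
        moreover have "1 \<le> r / \<epsilon>"
          using \<open>\<epsilon> \<le> r\<close> \<epsilon>pos by (simp add: pos_le_divide_eq)
        ultimately have "v (poly q 1 - poly q 0) \<le> 2 * M / (r / \<epsilon>)"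
          by (rule poly_lipschitz)
        moreover have "poly q 1 = Y j" "poly q 0 = X j"
          unfolding q[symmetric] by (simp_all add: w_def X_def Y_def)
        ultimately show ?thesis by simp
      qed
      have XY: "exp (- B) * T n \<le> vnorm v N X" "vnorm v N X \<le> M"
        "exp (- B) * T n \<le> vnorm v N Y"
        using bounds[OF y] bounds[OF z] QP by (auto simp: X_def Y_def Qy Rz M_def)
      have "v (X a * Y b - X b * Y a) \<le> C * \<epsilon> * (vnorm v N X * vnorm v N Y)"
        if ab: "a \<le> N" "b \<le> N" for a b
      proof -
        \<comment> \<open>The minors of \<open>X\<close> and \<open>Y\<close> are rewritten through
          differences \<open>Y l - X l\<close>, so \<open>D\<close> is the norm bound times the
          Lipschitz bound.\<close>
        define D where "D = M * (2 * M * \<epsilon> / r)"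
        have le: "v (X k * (Y l - X l)) \<le> D" if "k \<le> N" "l \<le> N" for k l
          unfolding v_mult D_def using lip[OF that(2)] v_le_vnorm[OF that(1), of X] XY(2)
          by (intro mult_mono) (auto simp: M_def T_def)
        have "X a * Y b - X b * Y a = X a * (Y b - X b) - X b * (Y a - X a)"
          by (simp add: algebra_simps)
        then have "v (X a * Y b - X b * Y a) \<le> D"
          using v_diff[of "X a * (Y b - X b)" "X b * (Y a - X a)"] le[of a b] le[of b a] ab by auto
        also have "D = C * \<epsilon> * ((exp (- B) * T n) * (exp (- B) * T n))"
        proof -
          have "exp B * exp B = exp (4 * B) * (exp (- B) * exp (- B))"
            by (simp flip: exp_add)
          then have "M * M = exp (4 * B) * ((exp (- B) * T n) * (exp (- B) * T n))"
            unfolding M_def by (metis (no_types, lifting) mult.assoc mult.left_commute)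
          then show ?thesis
            unfolding D_def C_def by (simp add: mult.assoc mult.left_commute)
        qed
        also have "\<dots> \<le> C * \<epsilon> * (vnorm v N X * vnorm v N Y)"
          using XY C \<epsilon>pos T by (intro mult_left_mono mult_mono) auto
        finally show ?thesis .
      qed
      then show ?thesis
        by (subst chordal_vec_le_iff) (auto simp: vnorm_pos nz)
    qed
    then show ?thesis
      unfolding phi \<epsilon> .
  qed
  then show ?thesis
    using r(1) C by blast
qed

text \<open>By the ultrametric inequality the closed disk contains the open ball of radius
  \<open>r\<close> around each of its points. It is therefore open, and the Lipschitz bound gives
  equicontinuity at all of its points.\<close>

lemma lipschitz_imp_fatou:
  assumes P: "P \<in> PN N" and r: "0 < r" and C: "0 < C"
    and lip: "\<And>Q R n. Q \<in> closed_disk v N P r \<Longrightarrow> R \<in> closed_disk v N P r \<Longrightarrow>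
      chordal v N ((phi ^^ n) Q) ((phi ^^ n) R) \<le> C * chordal v N Q R"
  shows "P \<in> fatou v N phi"
proof -
  have near: "R \<in> closed_disk v N P r"
    if "Q \<in> closed_disk v N P r" "R \<in> PN N" "chordal v N Q R < r" for Q R
    using that chordal_ultrametric[OF P _ that(2), of Q] by (auto simp: closed_disk_def)
  then have "chordal_open v N (closed_disk v N P r)"
    unfolding chordal_open_def using r by (auto simp: closed_disk_def)
  moreover have "equicont_at v N phi Q" if Q: "Q \<in> closed_disk v N P r" for Q
    unfolding equicont_at_def
  proof (intro allI impI)
    fix e :: real assume "0 < e"
    have "chordal v N ((phi ^^ n) Q) ((phi ^^ n) R) < e"
      if R: "R \<in> PN N" "chordal v N Q R < min r (e / C)" for R n
    proof -
      have "chordal v N ((phi ^^ n) Q) ((phi ^^ n) R) \<le> C * chordal v N Q R"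
        using near[OF Q] R by (intro lip Q) auto
      also have "\<dots> < e"
        using R C by (simp add: pos_less_divide_eq mult.commute)
      finally show ?thesis .
    qed
    then show "\<exists>\<delta>>0. \<forall>n\<ge>1. \<forall>R\<in>PN N. chordal v N Q R < \<delta> \<longrightarrow>
        chordal v N ((phi ^^ n) Q) ((phi ^^ n) R) < e"
      using r C \<open>0 < e\<close> by (intro exI[of _ "min r (e / C)"]) auto
  qed
  moreover have "P \<in> closed_disk v N P r"
    using P r chordal_self[OF P] by (simp add: closed_disk_def)
  ultimately show ?thesis
    unfolding fatou_def by blast
qed

lemma fatou_imp_equicont: "P \<in> fatou v N phi \<Longrightarrow> equicont_at v N phi P"
  unfolding fatou_def by blast

end

theorem theorem23:
  fixes v :: "'k::field \<Rightarrow> real"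
    and N d :: nat
    and phi :: "(nat \<Rightarrow> 'k) set \<Rightarrow> (nat \<Rightarrow> 'k) set"
    and Phi :: "nat \<Rightarrow> (nat \<Rightarrow> nat) \<Rightarrow> 'k"
    and P :: "(nat \<Rightarrow> 'k) set"
  assumes "alg_closed TYPE('k)"
    and "nonarch_abs v" and "nontrivial_abs v" and "complete_abs v"
    and "d \<ge> 2"
    and "is_lift N d Phi phi"
    and "P \<in> PN N"
  shows "(P \<in> fatou v N phi
            \<longleftrightarrow> (\<exists>r>0. \<exists>C>0. \<forall>Q\<in>closed_disk v N P r. \<forall>R\<in>closed_disk v N P r. \<forall>n.
                   chordal v N ((phi ^^ n) Q) ((phi ^^ n) R) \<le> C * chordal v N Q R))
       \<and> (P \<in> fatou v N phi
            \<longleftrightarrow> (\<exists>r>0. \<forall>Q\<in>PN N. chordal v N P Q < r \<longrightarrow>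
                   green_hat v N d Phi Q = green_hat v N d Phi P))"
    (is "(?a \<longleftrightarrow> ?b) \<and> (?a \<longleftrightarrow> ?c)")
proof -
  interpret nonarch_dynamics v N d Phi phi
    by unfold_locales fact+
  have "?a \<Longrightarrow> ?c"
    using equicont_imp_green_hat_const[OF assms(7) fatou_imp_equicont] .
  moreover have "?c \<Longrightarrow> ?b"
    using green_hat_const_imp_lipschitz[OF assms(7)] by blast
  moreover have "?b \<Longrightarrow> ?a"
    using lipschitz_imp_fatou[OF assms(7)] by blast
  ultimately show ?thesis by blast
qed

end
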